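(* Let $X=X_{\bar 0}\cup X_{\bar 1}$ be a superset and let $f\in \mathrm{Zin}(X)$ be a homogeneous element of degree greater than $1$. Then $f\in ST(X)$ if and only if $p(f)=-f$.
   Context: All (super)algebras are over a field $\mathbb K$ of characteristic $0$; a superalgebra is a $\mathbb Z_2$-graded algebra, and $|a|$ denotes the parity of a homogeneous element $a$. A Zinbiel superalgebra is a superalgebra with product $\circ$ satisfying $a\circ(b\circ c)=(a\circ b)\circ c+(-1)^{|a||b|}(b\circ a)\circ c$ for all homogeneous $a,b,c$. $\mathrm{Zin}(X)$ denotes the free Zinbiel superalgebra on the set of generators $X=X_{\bar 0}\cup X_{\bar 1}$ (elements of $X_{\bar 0}$ even, elements of $X_{\bar 1}$ odd). For $a_1,\dots,a_n\in \mathrm{Zin}(X)$, $a_1a_2\cdots a_n$ denotes the left-bracketed product $(\cdots(a_1\circ a_2)\cdots)\circ a_n$; the left-bracketed words $x_{i_1}\cdots x_{i_n}$ ($n\ge 1$, $x_{i_j}\in X$) form a basis of $\mathrm{Zin}(X)$. The degree of a word is the number of elements of $X$ (counted with repetition) appearing in it. $ST(X)$ is the free special Tortkara superalgebra on $X$: the sub-superalgebra of $(\mathrm{Zin}(X),[\cdot,\cdot])$ generated by $X$, where $[a,b]=a\circ b-(-1)^{|a||b|}b\circ a$. The linear map $p:\mathrm{Zin}(X)\to \mathrm{Zin}(X)$ is defined on basis words by $p(x_i)=-x_i$; $p(x_ix_j)=(-1)^{|x_i||x_j|}x_jx_i$; and $p(x_{i_1}\cdots x_{i_m}yz)=(-1)^{|y||z|}x_{i_1}\cdots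 x_{i_m}zy$ for $m\ge 1$, where $x_i,x_j,x_{i_1},\dots,x_{i_m},y,z\in X$. *)

theory Defs
  imports Complex_Main "HOL-Library.Poly_Mapping" "HOL-Library.Z2"
begin

section \<open>Superalgebras\<close>

text \<open>
  Parities live in the type \<^typ>\<open>bit\<close> of integers modulo 2. A \<open>\<int>\<^sub>2\<close>-graded space is a family
  \<open>V :: bit \<Rightarrow> 'v set\<close> of subspaces with \<open>V 0 \<inter> V 1 = {0}\<close>; the space itself is \<open>V 0 + V 1\<close>.
\<close>

text \<open>The default simp rules turn sums and products of parities into bitwise operations.\<close>

declare add_bit_eq_xor [simp del] mult_bit_eq_and [simp del]

definition koszul :: "bit \<Rightarrow> 'k::ring_1" where
  "koszul b = (if b = 1 then - 1 else 1)"

definition carrier_of :: "(bit \<Rightarrow> 'v::ab_group_add set) \<Rightarrow> 'v set" where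
  "carrier_of V = {a + b | a b. a \<in> V 0 \<and> b \<in> V 1}"

locale superalgebra = vector_space scale
  for scale :: "'k::field \<Rightarrow> 'v::ab_group_add \<Rightarrow> 'v" +
  fixes V :: "bit \<Rightarrow> 'v set" and mul :: "'v \<Rightarrow> 'v \<Rightarrow> 'v"
  assumes subspace_part: "subspace (V q)"
    and direct: "V 0 \<inter> V 1 = {0}"
    and mul_graded: "a \<in> V q \<Longrightarrow> b \<in> V r \<Longrightarrow> mul a b \<in> V (q + r)"
    and mul_add_left: "\<lbrakk>a \<in> carrier_of V; b \<in> carrier_of V; c \<in> carrier_of V\<rbrakk>
      \<Longrightarrow> mul (a + b) c = mul a c + mul b c"
    and mul_add_right: "\<lbrakk>a \<in> carrier_of V; b \<in> carrier_of V; c \<in> carrier_of V\<rbrakk>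
      \<Longrightarrow> mul a (b + c) = mul a b + mul a c"
    and mul_scale_left: "\<lbrakk>a \<in> carrier_of V; b \<in> carrier_of V\<rbrakk>
      \<Longrightarrow> mul (scale k a) b = scale k (mul a b)"
    and mul_scale_right: "\<lbrakk>a \<in> carrier_of V; b \<in> carrier_of V\<rbrakk>
      \<Longrightarrow> mul a (scale k b) = scale k (mul a b)"

locale zinbiel_superalgebra = superalgebra +
  assumes zinbiel: "\<lbrakk>a \<in> V q; b \<in> V r; c \<in> V t\<rbrakk>
    \<Longrightarrow> mul a (mul b c) = mul (mul a b) c + scale (koszul (q * r)) (mul (mul b a) c)"

definition superalgebra_hom ::
  "('k \<Rightarrow> 'v \<Rightarrow> 'v::ab_group_add) \<Rightarrow> (bit \<Rightarrow> 'v set) \<Rightarrow> ('v \<Rightarrow> 'v \<Rightarrow> 'v) \<Rightarrow>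
   ('k \<Rightarrow> 'w \<Rightarrow> 'w::ab_group_add) \<Rightarrow> (bit \<Rightarrow> 'w set) \<Rightarrow> ('w \<Rightarrow> 'w \<Rightarrow> 'w) \<Rightarrow> ('v \<Rightarrow> 'w) \<Rightarrow> bool" where
  "superalgebra_hom s V mul s' V' mul' h \<longleftrightarrow>
     (\<forall>q. \<forall>a\<in>V q. h a \<in> V' q) \<and>
     (\<forall>a\<in>carrier_of V. \<forall>b\<in>carrier_of V. h (a + b) = h a + h b) \<and>
     (\<forall>k. \<forall>a\<in>carrier_of V. h (s k a) = s' k (h a)) \<and>
     (\<forall>a\<in>carrier_of V. \<forall>b\<in>carrier_of V. h (mul a b) = mul' (h a) (h b))"

definition sub_superalgebra ::
  "('k::field \<Rightarrow> 'v \<Rightarrow> 'v::ab_group_add) \<Rightarrow> (bit \<Rightarrow> 'v set) \<Rightarrow> ('v \<Rightarrow> 'v \<Rightarrow> 'v) \<Rightarrow> 'v set \<Rightarrow> bool" where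
  "sub_superalgebra s V mul S \<longleftrightarrow>
     module.subspace s S \<and> S = carrier_of (\<lambda>q. S \<inter> V q) \<and> (\<forall>a\<in>S. \<forall>b\<in>S. mul a b \<in> S)"

definition generated_superalgebra ::
  "('k::field \<Rightarrow> 'v \<Rightarrow> 'v::ab_group_add) \<Rightarrow> (bit \<Rightarrow> 'v set) \<Rightarrow> ('v \<Rightarrow> 'v \<Rightarrow> 'v) \<Rightarrow> 'v set \<Rightarrow> 'v set" where
  "generated_superalgebra s V mul G = \<Inter>{S. sub_superalgebra s V mul S \<and> G \<subseteq> S}"

lemma carrier_of_I: "a \<in> V 0 \<Longrightarrow> b \<in> V 1 \<Longrightarrow> a + b \<in> carrier_of V"
  unfolding carrier_of_def by blast

lemma carrier_of_E:
  assumes "c \<in> carrier_of V"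
  obtains a b where "c = a + b" "a \<in> V 0" "b \<in> V 1"
  using assms unfolding carrier_of_def by blast

lemma (in superalgebra) part_zero: "0 \<in> V q"
  by (rule subspace_0[OF subspace_part])

lemma (in superalgebra) carrier_subspace: "subspace (carrier_of V)"
proof (rule subspaceI)
  show "0 \<in> carrier_of V"
    using carrier_of_I[OF part_zero part_zero] by simp
next
  fix x y
  assume "x \<in> carrier_of V" "y \<in> carrier_of V"
  then obtain a b c d where x: "x = a + b" "a \<in> V 0" "b \<in> V 1" and y: "y = c + d" "c \<in> V 0" "d \<in> V 1"
    by (elim carrier_of_E)
  have "(a + c) + (b + d) \<in> carrier_of V"
    by (intro carrier_of_I subspace_add[OF subspace_part] x y)
  moreover have "(a + c) + (b + d) = x + y"
    unfolding x(1) y(1) by (simp only: ac_simps)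
  ultimately show "x + y \<in> carrier_of V" by (simp only:)
next
  fix k x
  assume "x \<in> carrier_of V"
  then obtain a b where x: "x = a + b" "a \<in> V 0" "b \<in> V 1"
    by (elim carrier_of_E)
  show "scale k x \<in> carrier_of V"
    unfolding x(1) scale_right_distrib
    by (intro carrier_of_I subspace_scale[OF subspace_part] x)
qed

lemma (in superalgebra) part_subset_carrier:
  assumes "a \<in> V q"
  shows "a \<in> carrier_of V"
proof (cases q)
  assume "q = 0"
  with assms carrier_of_I[OF _ part_zero, of a] show ?thesis by simp
next
  assume "q = 1"
  with assms carrier_of_I[where V = V, OF part_zero, of a] show ?thesis by simp
qed

lemma (in superalgebra) mul_carrier:
  assumes "a \<in> carrier_of V" "b \<in> carrier_of V"
  shows "mul a b \<in> carrier_of V"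
proof -
  obtain c d where a: "a = c + d" "c \<in> V 0" "d \<in> V 1" using assms by (auto simp: carrier_of_def)
  obtain e f where b: "b = e + f" "e \<in> V 0" "f \<in> V 1" using assms by (auto simp: carrier_of_def)
  note C = part_subset_carrier[OF a(2)] part_subset_carrier[OF a(3)]
    part_subset_carrier[OF b(2)] part_subset_carrier[OF b(3)]
  have "mul a b = mul c e + mul c f + (mul d e + mul d f)"
    using C assms a(1) b(1) by (simp add: mul_add_left mul_add_right)
  moreover have "mul c e \<in> carrier_of V" "mul c f \<in> carrier_of V" "mul d e \<in> carrier_of V" "mul d f \<in> carrier_of V"
    by (rule part_subset_carrier[OF mul_graded], fact a b, fact a b)+
  ultimately show ?thesis
    by (simp only: subspace_add[OF carrier_subspace])
qed

lemma (in superalgebra) mul_zero: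
  assumes "a \<in> carrier_of V"
  shows "mul 0 a = 0" "mul a 0 = 0"
  using mul_scale_left[OF assms assms, of 0] mul_scale_right[OF assms assms, of 0] by simp_all

lemma (in superalgebra) part_unique:
  assumes "a + b = c + d" "a \<in> V 0" "b \<in> V 1" "c \<in> V 0" "d \<in> V 1"
  shows "a = c" "b = d"
proof -
  have "a - c = d - b" using assms(1) by (simp add: algebra_simps)
  moreover have "a - c \<in> V 0" "d - b \<in> V 1"
    using assms by (auto intro: subspace_diff subspace_part)
  ultimately have "a - c \<in> V 0 \<inter> V 1" by simp
  then show "a = c" by (simp add: direct)
  with assms(1) show "b = d" by simp
qed

lemma (in superalgebra) sub_superalgebra_carrier: "sub_superalgebra scale V mul (carrier_of V)"
proof -
  have "carrier_of V \<inter> V q = V q" for q by (auto intro: part_subset_carrier)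
  then have "(\<lambda>q. carrier_of V \<inter> V q) = V" by (intro ext)
  with carrier_subspace mul_carrier show ?thesis
    unfolding sub_superalgebra_def by simp
qed

lemma (in superalgebra) generated_subset_carrier:
  "G \<subseteq> carrier_of V \<Longrightarrow> generated_superalgebra scale V mul G \<subseteq> carrier_of V"
  unfolding generated_superalgebra_def using sub_superalgebra_carrier by blast

lemma (in superalgebra) sub_superalgebra_generated:
  assumes "G \<subseteq> carrier_of V"
  shows "sub_superalgebra scale V mul (generated_superalgebra scale V mul G)"
proof -
  let ?F = "{S. sub_superalgebra scale V mul S \<and> G \<subseteq> S}"
  let ?S = "generated_superalgebra scale V mul G"
  have S: "?S = \<Inter>?F" by (simp add: generated_superalgebra_def)
  have sub: "subspace ?S"
    unfolding S by (rule subspace_Inter) (auto simp only: sub_superalgebra_def)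
  have mul: "mul a b \<in> ?S" if "a \<in> ?S" "b \<in> ?S" for a b
    using that unfolding S sub_superalgebra_def by blast
  have "a \<in> carrier_of (\<lambda>q. ?S \<inter> V q)" if a: "a \<in> ?S" for a
  proof -
    have "a \<in> carrier_of V" using a generated_subset_carrier[OF assms] by blast
    then obtain c d where cd: "a = c + d" "c \<in> V 0" "d \<in> V 1" by (auto simp: carrier_of_def)
    have "c \<in> T \<and> d \<in> T" if "T \<in> ?F" for T
    proof -
      have "a \<in> carrier_of (\<lambda>q. T \<inter> V q)"
        using a that unfolding S sub_superalgebra_def by blast
      then obtain c' d' where "a = c' + d'" "c' \<in> T \<inter> V 0" "d' \<in> T \<inter> V 1"
        by (auto simp: carrier_of_def)
      with part_unique[of c d c' d'] cd show ?thesis by auto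
    qed
    with cd show ?thesis unfolding S carrier_of_def by blast
  qed
  moreover have "carrier_of (\<lambda>q. ?S \<inter> V q) \<subseteq> ?S"
    using subspace_add[OF sub] by (auto simp: carrier_of_def)
  ultimately show ?thesis
    using sub mul unfolding sub_superalgebra_def by blast
qed


section \<open>Linear combinations of words\<close>

type_synonym ('x, 'k) words = "'x list \<Rightarrow>\<^sub>0 'k"

abbreviation word :: "'x list \<Rightarrow> ('x, 'k::zero_neq_one) words" where
  "word w \<equiv> Poly_Mapping.single w 1"

abbreviation gen :: "'x \<Rightarrow> ('x, 'k::zero_neq_one) words" where
  "gen x \<equiv> word [x]"

definition smult :: "'k::field \<Rightarrow> ('x, 'k) words \<Rightarrow> ('x, 'k) words" where
  "smult k = Poly_Mapping.map ((*) k)"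

lemma lookup_smult: "Poly_Mapping.lookup (smult k f) w = k * Poly_Mapping.lookup f w"
  unfolding smult_def by (simp add: Poly_Mapping.map.rep_eq when_def)

definition linext :: "('k::zero \<Rightarrow> 'v \<Rightarrow> 'v::comm_monoid_add) \<Rightarrow> ('x list \<Rightarrow> 'v) \<Rightarrow> ('x, 'k) words \<Rightarrow> 'v" where
  "linext s h f = (\<Sum>w\<in>Poly_Mapping.keys f. s (Poly_Mapping.lookup f w) (h w))"

definition bilext :: "('x list \<Rightarrow> 'x list \<Rightarrow> ('x, 'k::field) words) \<Rightarrow>
    ('x, 'k) words \<Rightarrow> ('x, 'k) words \<Rightarrow> ('x, 'k) words" where
  "bilext h f g = linext smult (\<lambda>u. linext smult (h u) g) f"


interpretation words: vector_space "smult :: 'k::field \<Rightarrow> ('x, 'k) words \<Rightarrow> _"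
  by unfold_locales
    (auto intro!: poly_mapping_eqI simp: lookup_smult lookup_add algebra_simps)

lemma linext_superset:
  fixes s :: "'k::field \<Rightarrow> 'v::ab_group_add \<Rightarrow> 'v"
  assumes "vector_space s" "finite A" "Poly_Mapping.keys f \<subseteq> A"
  shows "linext s h f = (\<Sum>w\<in>A. s (Poly_Mapping.lookup f w) (h w))"
proof -
  interpret vector_space s by fact
  show ?thesis
    unfolding linext_def using assms(2,3)
    by (intro sum.mono_neutral_left) (auto simp: in_keys_iff)
qed

lemma linear_linext:
  fixes s :: "'k::field \<Rightarrow> 'v::ab_group_add \<Rightarrow> 'v"
  assumes "vector_space s"
  shows "Vector_Spaces.linear smult s (linext s h)"
proof -
  interpret vector_space s by fact
  have "linext s h (f + g) = linext s h f + linext s h g" for f g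
  proof -
    let ?A = "Poly_Mapping.keys f \<union> Poly_Mapping.keys g"
    have "finite ?A" by simp
    note L = linext_superset[OF assms this]
    show ?thesis
      using Poly_Mapping.keys_add[of f g]
      by (simp add: L lookup_add scale_left_distrib sum.distrib)
  qed
  moreover have "linext s h (smult k f) = s k (linext s h f)" for k f
  proof -
    have "Poly_Mapping.keys (smult k f) \<subseteq> Poly_Mapping.keys f"
      by (auto simp: in_keys_iff lookup_smult)
    from linext_superset[OF assms finite_keys this, of h]
    show ?thesis by (simp add: linext_def scale_sum_right lookup_smult)
  qed
  ultimately show ?thesis
    by unfold_locales
qed

lemma linext_word [simp]:
  fixes s :: "'k::field \<Rightarrow> 'v::ab_group_add \<Rightarrow> 'v"
  assumes "vector_space s"
  shows "linext s h (word w) = h w"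
proof -
  interpret vector_space s by fact
  show ?thesis by (simp add: linext_def)
qed

lemma words_expand: "f = (\<Sum>w\<in>Poly_Mapping.keys f. smult (Poly_Mapping.lookup f w) (word w))"
  for f :: "('x, 'k::field) words"
proof (rule poly_mapping_eqI)
  fix v
  show "Poly_Mapping.lookup f v =
    Poly_Mapping.lookup (\<Sum>w\<in>Poly_Mapping.keys f. smult (Poly_Mapping.lookup f w) (word w)) v"
    by (cases "v \<in> Poly_Mapping.keys f")
      (auto simp: lookup_sum lookup_smult lookup_single when_def in_keys_iff if_distrib sum.delta cong: if_cong)
qed
lemma vector_space_smult [simp]: "vector_space smult"
  by (rule words.vector_space_axioms)

context
  fixes s :: "'k::field \<Rightarrow> 'v::ab_group_add \<Rightarrow> 'v"
  assumes s: "vector_space s"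
begin

interpretation s: vector_space s by (rule s)

lemma linext_add: "linext s h (f + g) = linext s h f + linext s h g"
  using linear_linext[OF s, of h] by (simp add: Vector_Spaces.linear_iff)

lemma linext_smult: "linext s h (smult k f) = s k (linext s h f)"
  using linear_linext[OF s, of h] by (simp add: Vector_Spaces.linear_iff)

lemma linext_fun_add: "linext s (\<lambda>w. h w + h' w) f = linext s h f + linext s h' f"
  by (simp add: linext_def s.scale_right_distrib sum.distrib)

lemma linext_fun_scale: "linext s (\<lambda>w. s k (h w)) f = s k (linext s h f)"
  by (simp add: linext_def s.scale_sum_right mult.commute)

end

lemma linext_zero [simp]: "linext s h 0 = 0"
  by (simp add: linext_def)

lemmas linext_words_simps [simp] =
  linext_add[OF vector_space_smult] linext_smult[OF vector_space_smult]

lemma bilext_simps [simp]: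
  "bilext h (f + f') g = bilext h f g + bilext h f' g"
  "bilext h f (g + g') = bilext h f g + bilext h f g'"
  "bilext h (smult k f) g = smult k (bilext h f g)"
  "bilext h f (smult k g) = smult k (bilext h f g)"
  "bilext h 0 g = 0"
  "bilext h (word u) (word v) = h u v"
  by (simp_all add: bilext_def linext_fun_add linext_fun_scale[OF vector_space_smult])

lemma bilext_zero_right [simp]: "bilext h f 0 = 0"
  using bilext_simps(4)[of h f 0 0] by simp

lemma words_induct [consumes 1, case_names zero add word]:
  fixes f :: "('x, 'k::field) words"
  assumes "Poly_Mapping.keys f \<subseteq> A"
    and zero: "P 0"
    and add: "\<And>f g. \<lbrakk>Poly_Mapping.keys f \<subseteq> A; Poly_Mapping.keys g \<subseteq> A; P f; P g\<rbrakk> \<Longrightarrow> P (f + g)"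
    and word: "\<And>k w. w \<in> A \<Longrightarrow> P (smult k (word w))"
  shows "P f"
proof -
  define part where "part B = (\<Sum>w\<in>B. smult (Poly_Mapping.lookup f w) (word w))" for B
  have "Poly_Mapping.keys (part B) \<subseteq> A \<and> P (part B)" if "finite B" "B \<subseteq> A" for B
    using that
  proof (induction B rule: finite_induct)
    case empty
    show ?case by (simp add: part_def zero)
  next
    case (insert w B)
    let ?w = "smult (Poly_Mapping.lookup f w) (word w)"
    have part: "part (insert w B) = ?w + part B"
      using insert.hyps by (simp add: part_def)
    have w: "Poly_Mapping.keys ?w \<subseteq> A"
      using insert.prems by (auto simp: in_keys_iff lookup_smult lookup_single when_def split: if_splits)
    have IH: "Poly_Mapping.keys (part B) \<subseteq> A" "P (part B)"
      using insert by auto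
    have "Poly_Mapping.keys (?w + part B) \<subseteq> A"
      by (rule order_trans[OF keys_add]) (rule Un_least[OF w IH(1)])
    moreover have "P (?w + part B)"
      by (rule add[OF w IH(1) word IH(2)]) (use insert.prems in simp)
    ultimately show ?case by (simp only: part)
  qed
  from this[OF finite_keys assms(1)] have "P (part (Poly_Mapping.keys f))" ..
  moreover have "part (Poly_Mapping.keys f) = f"
    unfolding part_def by (rule words_expand[symmetric])
  ultimately show ?thesis by (rule back_subst)
qed


section \<open>The free Zinbiel superalgebra\<close>

text \<open>
  The superset of generators is a set \<open>X\<close> with a parity function \<open>par\<close>, so that
  \<open>X\<^sub>q = {x \<in> X. par x = q}\<close>. The nonempty word \<open>[x\<^sub>1, \<dots>, x\<^sub>n]\<close> stands for the left-bracketed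
  product \<open>(\<dots>(x\<^sub>1 \<circ> x\<^sub>2)\<dots>) \<circ> x\<^sub>n\<close> (lemma \<open>left_bracketed_eq_word\<close> below). The product of words is
  forced by the Zinbiel identity: \<open>u \<circ> x = ux\<close> and
  \<open>u \<circ> (vx) = u \<circ> (v \<circ> x) = (u \<circ> v + (-1)\<^bsup>|u||v|\<^esup> v \<circ> u) x\<close> for a generator \<open>x\<close>.
  Theorems \<open>zinbiel_Zin\<close>, \<open>Zin_universal_exists\<close> and \<open>Zin_universal_unique\<close> show that
  the result is the free Zinbiel superalgebra on \<open>X\<close>.
\<close>

definition wpar :: "('x \<Rightarrow> bit) \<Rightarrow> 'x list \<Rightarrow> bit" where
  "wpar par w = (\<Sum>x\<leftarrow>w. par x)"

definition snoc :: "'x \<Rightarrow> ('x, 'k::field) words \<Rightarrow> ('x, 'k) words" where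
  "snoc x = linext smult (\<lambda>w. word (w @ [x]))"

text \<open>The empty word does not belong to the algebra; the value 0 for \<open>v = []\<close> is a dummy.\<close>

function wmul :: "('x \<Rightarrow> bit) \<Rightarrow> 'x list \<Rightarrow> 'x list \<Rightarrow> ('x, 'k::field) words" where
  "wmul par u v =
     (if v = [] then 0
      else if butlast v = [] then word (u @ v)
      else snoc (last v) (wmul par u (butlast v) +
             smult (koszul (wpar par u * wpar par (butlast v))) (wmul par (butlast v) u)))"
  by pat_completeness auto
termination
  by (relation "Wellfounded.measure (\<lambda>(_, u, v). length u + length v)") auto

declare wmul.simps [simp del]

definition zmul :: "('x \<Rightarrow> bit) \<Rightarrow> ('x, 'k::field) words \<Rightarrow> ('x, 'k) words \<Rightarrow> ('x, 'k) words" where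
  "zmul par = bilext (wmul par)"

definition Zin :: "'x set \<Rightarrow> ('x, 'k::field) words set" where
  "Zin X = {f. Poly_Mapping.keys f \<subseteq> lists X - {[]}}"

definition Zin_part :: "'x set \<Rightarrow> ('x \<Rightarrow> bit) \<Rightarrow> bit \<Rightarrow> ('x, 'k::field) words set" where
  "Zin_part X par q = {f \<in> Zin X. \<forall>w\<in>Poly_Mapping.keys f. wpar par w = q}"

definition left_bracketed :: "('x \<Rightarrow> bit) \<Rightarrow> 'x \<Rightarrow> 'x list \<Rightarrow> ('x, 'k::field) words" where
  "left_bracketed par x ys = foldl (zmul par) (gen x) (map gen ys)"

definition homogeneous_of_degree :: "nat \<Rightarrow> ('x, 'k::field) words \<Rightarrow> bool" where
  "homogeneous_of_degree n f \<longleftrightarrow> (\<forall>w\<in>Poly_Mapping.keys f. length w = n)"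

subsection \<open>It is the free Zinbiel superalgebra\<close>

lemma zmul_simps [simp]:
  "zmul par (f + f') g = zmul par f g + zmul par f' g"
  "zmul par f (g + g') = zmul par f g + zmul par f g'"
  "zmul par (smult k f) g = smult k (zmul par f g)"
  "zmul par f (smult k g) = smult k (zmul par f g)"
  "zmul par 0 g = 0"
  "zmul par f 0 = 0"
  "zmul par (word u) (word v) = wmul par u v"
  by (simp_all add: zmul_def)

lemma snoc_simps [simp]:
  "snoc x (f + g) = snoc x f + snoc x g"
  "snoc x (smult k f) = smult k (snoc x f)"
  "snoc x 0 = 0"
  "snoc x (word w) = word (w @ [x])"
  by (simp_all add: snoc_def)

lemma zmul_diff [simp]:
  "zmul par (f - f') g = zmul par f g - zmul par f' g"
  "zmul par f (g - g') = zmul par f g - zmul par f g'"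
  using zmul_simps(1)[of par "f - f'" f' g] zmul_simps(2)[of par f "g - g'" g']
  by (simp_all del: zmul_simps add: eq_diff_eq)

lemma snoc_diff [simp]: "snoc x (f - g) = snoc x f - snoc x g"
  using snoc_simps(1)[of x "f - g" g] by (simp del: snoc_simps add: eq_diff_eq)

lemma wpar_simps [simp]:
  "wpar par [] = 0" "wpar par (x # w) = par x + wpar par w"
  "wpar par (u @ v) = wpar par u + wpar par v"
  by (simp_all add: wpar_def)

lemma wmul_gen [simp]: "wmul par u [x] = word (u @ [x])"
  by (subst wmul.simps) simp

lemma wmul_snoc: "v \<noteq> [] \<Longrightarrow> wmul par u (v @ [x]) =
    snoc x (wmul par u v + smult (koszul (wpar par u * wpar par v)) (wmul par v u))"
  by (subst wmul.simps) simp

lemma left_bracketed_eq_word: "left_bracketed par x ys = word (x # ys)"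
  unfolding left_bracketed_def by (induction ys rule: rev_induct) auto

definition part_words :: "'x set \<Rightarrow> ('x \<Rightarrow> bit) \<Rightarrow> bit \<Rightarrow> 'x list set" where
  "part_words X par q = {w \<in> lists X - {[]}. wpar par w = q}"

lemma Zin_part_iff: "f \<in> Zin_part X par q \<longleftrightarrow> Poly_Mapping.keys f \<subseteq> part_words X par q"
  by (auto simp: Zin_part_def Zin_def part_words_def)

lemma subspace_keys: "words.subspace {f. Poly_Mapping.keys f \<subseteq> A}"
  unfolding words.subspace_def
  by (auto simp: lookup_smult in_keys_iff lookup_add subset_iff) (metis add.right_neutral)

lemma subspace_Zin_part: "words.subspace (Zin_part X par q :: ('x, 'k::field) words set)"
proof -
  have "(Zin_part X par q :: ('x, 'k) words set) = {f. Poly_Mapping.keys f \<subseteq> part_words X par q}"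
    by (auto simp: Zin_part_iff)
  then show ?thesis by (simp add: subspace_keys)
qed

lemma subspace_Zin: "words.subspace (Zin X)"
  unfolding Zin_def by (rule subspace_keys)

lemma carrier_of_Zin_part: "carrier_of (Zin_part X par) = (Zin X :: ('x, 'k::field) words set)"
proof (intro equalityI subsetI)
  fix f :: "('x, 'k) words"
  assume "f \<in> carrier_of (Zin_part X par)"
  then obtain a b where "f = a + b" "a \<in> Zin X" "b \<in> Zin X"
    by (auto simp: carrier_of_def Zin_part_def)
  then show "f \<in> Zin X" by (simp add: words.subspace_add[OF subspace_Zin])
next
  fix f :: "('x, 'k) words"
  assume "f \<in> Zin X"
  then have "Poly_Mapping.keys f \<subseteq> lists X - {[]}" by (simp add: Zin_def)
  then show "f \<in> carrier_of (Zin_part X par)"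
  proof (induction rule: words_induct)
    case zero
    then show ?case
      using words.subspace_0[OF subspace_Zin_part] by (force simp: carrier_of_def)
  next
    case (add f g)
    then obtain a b c d where "f = a + b" "a \<in> Zin_part X par 0" "b \<in> Zin_part X par 1"
      "g = c + d" "c \<in> Zin_part X par 0" "d \<in> Zin_part X par 1"
      by (auto simp: carrier_of_def)
    then have "f + g = (a + c) + (b + d)" "a + c \<in> Zin_part X par 0" "b + d \<in> Zin_part X par 1"
      by (simp_all add: words.subspace_add[OF subspace_Zin_part])
    then show ?case unfolding carrier_of_def by blast
  next
    case (word k w)
    then have *: "smult k (word w) \<in> Zin_part X par (wpar par w)"
      by (auto simp: Zin_part_def Zin_def in_keys_iff lookup_smult lookup_single when_def split: if_splits)
    have 0: "0 \<in> Zin_part X par q" for q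
      by (rule words.subspace_0[OF subspace_Zin_part])
    consider "wpar par w = 0" | "wpar par w = 1" by (cases "wpar par w")
    then show ?case
    proof cases
      case 1
      with * have "smult k (word w) = smult k (word w) + 0 \<and> smult k (word w) \<in> Zin_part X par 0" by simp
      then show ?thesis unfolding carrier_of_def using "0" by blast
    next
      case 2
      with * have "smult k (word w) = 0 + smult k (word w) \<and> smult k (word w) \<in> Zin_part X par 1" by simp
      then show ?thesis unfolding carrier_of_def using "0" by blast
    qed
  qed
qed

lemma Zin_part_zero [simp]: "0 \<in> Zin_part X par q"
  by (rule words.subspace_0[OF subspace_Zin_part])

lemma Zin_part_add: "f \<in> Zin_part X par q \<Longrightarrow> g \<in> Zin_part X par q \<Longrightarrow> f + g \<in> Zin_part X par q"
  by (rule words.subspace_add[OF subspace_Zin_part])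

lemma Zin_part_smult: "f \<in> Zin_part X par q \<Longrightarrow> smult k f \<in> Zin_part X par q"
  by (rule words.subspace_scale[OF subspace_Zin_part])

lemma word_in_Zin_part: "w \<in> part_words X par q \<Longrightarrow> word w \<in> Zin_part X par q"
  by (simp add: Zin_part_iff)

lemma snoc_in_Zin_part:
  assumes "f \<in> Zin_part X par q" "x \<in> X"
  shows "snoc x f \<in> Zin_part X par (q + par x)"
  using assms(1)[unfolded Zin_part_iff]
proof (induction rule: words_induct)
  case (word k w)
  then show ?case using assms(2)
    by (auto intro!: Zin_part_smult word_in_Zin_part simp: part_words_def)
qed (simp_all add: Zin_part_add)

lemma wmul_in_Zin_part:
  assumes "u \<in> lists X - {[]}" "v \<in> lists X - {[]}"
  shows "(wmul par u v :: ('x, 'k::field) words) \<in> Zin_part X par (wpar par u + wpar par v)"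
  using assms
proof (induction "length u + length v" arbitrary: u v rule: less_induct)
  case less
  from less.prems obtain v' x where v: "v = v' @ [x]" by (metis DiffD2 insertCI rev_exhaust)
  show ?case
  proof (cases "v' = []")
    case True
    with less.prems v show ?thesis
      by (auto intro!: word_in_Zin_part simp: part_words_def)
  next
    case False
    then have "(wmul par u v' :: ('x, 'k) words) \<in> Zin_part X par (wpar par u + wpar par v')"
      "(wmul par v' u :: ('x, 'k) words) \<in> Zin_part X par (wpar par u + wpar par v')"
      using less.hyps[of u v'] less.hyps[of v' u] less.prems v by (auto simp: add.commute)
    from snoc_in_Zin_part[OF Zin_part_add[OF this(1) Zin_part_smult[OF this(2)]], of x]
    show ?thesis using False less.prems v by (simp add: wmul_snoc add.assoc)
  qed
qed

lemma bilext_in_Zin_part: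
  assumes h: "\<And>u v. u \<in> part_words X par q \<Longrightarrow> v \<in> part_words X par r \<Longrightarrow> h u v \<in> Zin_part X par t"
    and f: "f \<in> Zin_part X par q" and g: "g \<in> Zin_part X par r"
  shows "bilext h f g \<in> Zin_part X par t"
  using f[unfolded Zin_part_iff]
proof (induction rule: words_induct)
  case (word k u)
  note u = word
  from g[unfolded Zin_part_iff] show ?case
  proof (induction rule: words_induct)
    case (word l v)
    then show ?case by (simp add: Zin_part_smult h u)
  qed (simp_all add: Zin_part_add)
qed (simp_all add: Zin_part_add)

lemma zmul_in_Zin_part:
  "f \<in> Zin_part X par q \<Longrightarrow> g \<in> Zin_part X par r \<Longrightarrow> zmul par f g \<in> Zin_part X par (q + r)"
  unfolding zmul_def by (rule bilext_in_Zin_part) (auto simp: part_words_def intro!: wmul_in_Zin_part)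

lemma Zin_part_direct: "Zin_part X par 0 \<inter> Zin_part X par 1 = {0 :: ('x, 'k::field) words}"
proof -
  have "f = 0" if "f \<in> Zin_part X par 0" "f \<in> Zin_part X par 1" for f :: "('x, 'k) words"
    using that by (intro poly_mapping_eqI) (force simp: Zin_part_def in_keys_iff)
  then show ?thesis by auto
qed

lemma superalgebra_Zin: "superalgebra smult (Zin_part X par) (zmul par)"
  by unfold_locales (simp_all add: subspace_Zin_part Zin_part_direct zmul_in_Zin_part)

lemma zmul_gen: "zmul par f (gen x) = snoc x f"
proof -
  have "Poly_Mapping.keys f \<subseteq> UNIV" by simp
  then show ?thesis by (induction rule: words_induct) simp_all
qed

lemma zmul_snoc:
  assumes f: "f \<in> Zin_part X par q" and g: "g \<in> Zin_part X par r"
  shows "zmul par f (snoc x g) = snoc x (zmul par f g + smult (koszul (q * r)) (zmul par g f))"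
  using f[unfolded Zin_part_iff]
proof (induction rule: words_induct)
  case (word k u)
  note u = word
  from g[unfolded Zin_part_iff] show ?case
  proof (induction rule: words_induct)
    case (word l v)
    then show ?case using u
      by (simp add: part_words_def wmul_snoc words.scale_right_distrib mult_ac)
  qed (simp_all add: words.scale_right_distrib algebra_simps)
qed (simp_all add: words.scale_right_distrib algebra_simps)

lemma koszul_simps [simp]: "koszul 0 = 1" "koszul 1 = - 1"
  by (simp_all add: koszul_def)

lemma zinbiel_words:
  assumes "u \<noteq> []" "v \<noteq> []" "w \<noteq> []"
  shows "(zmul par (word u) (wmul par v w) :: ('x, 'k::field) words) = zmul par (wmul par u v) (word w) +
    smult (koszul (wpar par u * wpar par v)) (zmul par (wmul par v u) (word w))"
  using assms
proof (induction "length u + length v + length w" arbitrary: u v w rule: less_induct)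
  case less
  have W: "(word u :: ('x, 'k) words) \<in> Zin_part UNIV par (wpar par u)" if "u \<noteq> []" for u
    using that by (simp add: word_in_Zin_part part_words_def)
  have M: "(wmul par u v :: ('x, 'k) words) \<in> Zin_part UNIV par (wpar par u + wpar par v)" if "u \<noteq> []" "v \<noteq> []" for u v
    using that by (simp add: wmul_in_Zin_part)
  from less.prems obtain w' x where w: "w = w' @ [x]" by (metis rev_exhaust)
  show ?case
  proof (cases "w' = []")
    case True
    have "zmul par (word u) (snoc x (word v)) =
      (snoc x (zmul par (word u) (word v) + smult (koszul (wpar par u * wpar par v)) (zmul par (word v) (word u))) :: ('x, 'k) words)"
      using less.prems by (intro zmul_snoc[where X = UNIV] W)
    with True w show ?thesis by (simp add: zmul_gen)
  next
    case False
    note ne = less.prems(1,2) False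
    define q r t where "q = wpar par u" and "r = wpar par v" and "t = wpar par w'"
    have IH:
      "(zmul par (word u) (wmul par v w') :: ('x, 'k) words) = zmul par (wmul par u v) (word w') +
         smult (koszul (q * r)) (zmul par (wmul par v u) (word w'))"
      "(zmul par (word u) (wmul par w' v) :: ('x, 'k) words) = zmul par (wmul par u w') (word v) +
         smult (koszul (q * t)) (zmul par (wmul par w' u) (word v))"
      "(zmul par (word w') (wmul par u v) :: ('x, 'k) words) = zmul par (wmul par w' u) (word v) +
         smult (koszul (t * q)) (zmul par (wmul par u w') (word v))"
      "(zmul par (word w') (wmul par v u) :: ('x, 'k) words) = zmul par (wmul par w' v) (word u) +
         smult (koszul (t * r)) (zmul par (wmul par v w') (word u))"
      unfolding q_def r_def t_def using ne w
      by (intro less.hyps; simp)+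
    have 1: "(wmul par v w' + smult (koszul (r * t)) (wmul par w' v) :: ('x, 'k) words) \<in> Zin_part UNIV par (r + t)"
      using M[of v w'] M[of w' v] ne
      by (intro Zin_part_add Zin_part_smult) (simp_all add: q_def r_def t_def add.commute)
    have lhs: "(zmul par (word u) (wmul par v w) :: ('x, 'k) words) = snoc x
       (zmul par (word u) (wmul par v w' + smult (koszul (r * t)) (wmul par w' v)) +
        smult (koszul (q * (r + t))) (zmul par (wmul par v w' + smult (koszul (r * t)) (wmul par w' v)) (word u)))"
      using zmul_snoc[OF W 1, of u x] ne by (simp only: w wmul_snoc[OF False]) (simp add: q_def r_def t_def)
    have rhs1: "(zmul par (wmul par u v) (word w) :: ('x, 'k) words) = snoc x
       (zmul par (wmul par u v) (word w') + smult (koszul ((q + r) * t)) (zmul par (word w') (wmul par u v)))"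
      using zmul_snoc[OF M W, of u v w' x] ne by (simp add: w q_def r_def t_def)
    have rhs2: "(zmul par (wmul par v u) (word w) :: ('x, 'k) words) = snoc x
       (zmul par (wmul par v u) (word w') + smult (koszul ((q + r) * t)) (zmul par (word w') (wmul par v u)))"
      using zmul_snoc[OF M W, of v u w' x] ne by (simp add: w q_def r_def t_def add.commute)
    show ?thesis
      unfolding lhs rhs1 rhs2 q_def[symmetric] r_def[symmetric] t_def[symmetric]
      by (cases q; cases r; cases t) (simp_all add: IH words.scale_right_distrib algebra_simps)
  qed
qed

theorem zinbiel_Zin:
  fixes X :: "'x set"
  shows "zinbiel_superalgebra (smult :: 'k::field \<Rightarrow> ('x, 'k) words \<Rightarrow> _) (Zin_part X par) (zmul par)"
proof -
  interpret superalgebra "smult :: 'k \<Rightarrow> ('x, 'k) words \<Rightarrow> _" "Zin_part X par" "zmul par"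
    by (rule superalgebra_Zin)
  show ?thesis
  proof
    fix f g h :: "('x, 'k) words" and q r t
    assume f: "f \<in> Zin_part X par q" and g: "g \<in> Zin_part X par r" and h: "h \<in> Zin_part X par t"
    from f[unfolded Zin_part_iff]
    show "zmul par f (zmul par g h) =
      zmul par (zmul par f g) h + smult (koszul (q * r)) (zmul par (zmul par g f) h)"
    proof (induction rule: words_induct)
      case (word k u)
      note u = word
      from g[unfolded Zin_part_iff] show ?case
      proof (induction rule: words_induct)
        case (word l v)
        note v = word
        from h[unfolded Zin_part_iff] show ?case
        proof (induction rule: words_induct)
          case (word m w)
          with u v show ?case
            by (simp add: part_words_def zinbiel_words words.scale_right_distrib mult_ac)
        qed (simp_all add: words.scale_right_distrib algebra_simps)
      qed (simp_all add: words.scale_right_distrib algebra_simps)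
    qed (simp_all add: words.scale_right_distrib algebra_simps)
  qed
qed

theorem Zin_universal_exists:
  fixes scale :: "'k::field \<Rightarrow> 'v::ab_group_add \<Rightarrow> 'v" and X :: "'x set"
  assumes "zinbiel_superalgebra scale V mul" and \<phi>: "\<And>x. x \<in> X \<Longrightarrow> \<phi> x \<in> V (par x)"
  shows "\<exists>h. superalgebra_hom smult (Zin_part X par) (zmul par) scale V mul h \<and> (\<forall>x\<in>X. h (gen x) = \<phi> x)"
proof -
  interpret zinbiel_superalgebra scale V mul by fact
  have vs: "vector_space scale" by unfold_locales
  define hw where "hw w = foldl mul (\<phi> (hd w)) (map \<phi> (tl w))" for w
  have hw_gen: "hw [x] = \<phi> x" for x by (simp add: hw_def)
  have hw_snoc: "hw (w @ [x]) = mul (hw w) (\<phi> x)" if "w \<noteq> []" for w x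
    using that by (simp add: hw_def)
  have hw_part: "hw w \<in> V (wpar par w)" if "w \<in> lists X - {[]}" for w
    using that
  proof (induction w rule: rev_induct)
    case (snoc x w)
    then show ?case
      by (cases "w = []") (auto simp: hw_gen hw_snoc \<phi> intro!: mul_graded)
  qed simp
  define h where "h = linext scale hw"
  have h_simps [simp]: "h (f + g) = h f + h g" "h (smult k f) = scale k (h f)" "h 0 = 0" "h (word w) = hw w"
    for f g :: "('x, 'k) words" and k w by (simp_all add: h_def linext_add[OF vs] linext_smult[OF vs] linext_word[OF vs])
  have h_part: "h f \<in> V q" if "f \<in> Zin_part X par q" for f q
    using that[unfolded Zin_part_iff]
  proof (induction rule: words_induct)
    case (word k w)
    then show ?case using hw_part[of w]
      by (auto simp: part_words_def intro!: subspace_scale[OF subspace_part])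
  qed (simp_all add: subspace_0[OF subspace_part] subspace_add[OF subspace_part])
  have h_carrier: "h f \<in> carrier_of V" if "Poly_Mapping.keys f \<subseteq> lists X - {[]}" for f
  proof -
    have "f \<in> carrier_of (Zin_part X par)" using that by (simp add: carrier_of_Zin_part Zin_def)
    then show ?thesis by (auto simp: carrier_of_def) (use h_part in blast)
  qed
  have hw_carrier: "hw w \<in> carrier_of V" if "w \<in> lists X - {[]}" for w
    using h_carrier[of "word w"] that by simp
  have h_snoc: "h (snoc x f) = mul (h f) (\<phi> x)"
    if "Poly_Mapping.keys f \<subseteq> lists X - {[]}" "x \<in> X" for f x
    using that(1)
  proof (induction rule: words_induct)
    case zero
    then show ?case using part_subset_carrier[OF \<phi>[OF that(2)]] by (simp add: mul_zero)
  next
    case (add f g)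
    then show ?case using part_subset_carrier[OF \<phi>[OF that(2)]] by (simp add: mul_add_left h_carrier)
  next
    case (word k w)
    then show ?case using part_subset_carrier[OF \<phi>[OF that(2)]] hw_carrier[OF word]
      by (simp add: mul_scale_left hw_snoc)
  qed
  have h_wmul: "h (wmul par u v) = mul (hw u) (hw v)"
    if "u \<in> lists X - {[]}" "v \<in> lists X - {[]}" for u v
    using that
  proof (induction "length u + length v" arbitrary: u v rule: less_induct)
    case less
    from less.prems obtain v' x where v: "v = v' @ [x]" by (metis DiffD2 insertCI rev_exhaust)
    show ?case
    proof (cases "v' = []")
      case True
      with less.prems v show ?thesis by (simp add: hw_gen hw_snoc)
    next
      case False
      then have v': "v' \<in> lists X - {[]}" and x: "x \<in> X" using less.prems v by auto
      have IH: "h (wmul par u v') = mul (hw u) (hw v')" "h (wmul par v' u) = mul (hw v') (hw u)"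
        using less.hyps[of u v'] less.hyps[of v' u] less.prems v v' by auto
      have keys: "Poly_Mapping.keys (wmul par u v' + smult (koszul (wpar par u * wpar par v')) (wmul par v' u) :: ('x, 'k) words)
          \<subseteq> lists X - {[]}"
      proof -
        have "(wmul par u v' :: ('x, 'k) words) \<in> Zin X" "(wmul par v' u :: ('x, 'k) words) \<in> Zin X"
          using wmul_in_Zin_part[OF less.prems(1) v'] wmul_in_Zin_part[OF v' less.prems(1)]
          by (auto simp: Zin_part_def)
        then have "(wmul par u v' + smult (koszul (wpar par u * wpar par v')) (wmul par v' u) :: ('x, 'k) words) \<in> Zin X"
          by (intro words.subspace_add[OF subspace_Zin] words.subspace_scale[OF subspace_Zin])
        then show ?thesis by (simp add: Zin_def)
      qed
      have C: "hw u \<in> carrier_of V" "hw v' \<in> carrier_of V" "\<phi> x \<in> carrier_of V"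
        using hw_carrier less.prems v' part_subset_carrier[OF \<phi>[OF x]] by auto
      have "h (wmul par u v) =
          mul (mul (hw u) (hw v') + scale (koszul (wpar par u * wpar par v')) (mul (hw v') (hw u))) (\<phi> x)"
        using h_snoc[OF keys x] False by (simp add: v wmul_snoc IH)
      also have "\<dots> = mul (mul (hw u) (hw v')) (\<phi> x) +
          scale (koszul (wpar par u * wpar par v')) (mul (mul (hw v') (hw u)) (\<phi> x))"
        using C by (simp add: mul_add_left mul_scale_left mul_carrier subspace_scale[OF carrier_subspace])
      also have "\<dots> = mul (hw u) (mul (hw v') (\<phi> x))"
        using less.prems v' x by (intro zinbiel[where t = "par x", symmetric] hw_part \<phi>)
      finally show ?thesis using False by (simp add: v hw_snoc)
    qed
  qed
  have h_mul: "h (zmul par f g) = mul (h f) (h g)"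
    if f: "Poly_Mapping.keys f \<subseteq> lists X - {[]}" and g: "Poly_Mapping.keys g \<subseteq> lists X - {[]}" for f g
    using f
  proof (induction rule: words_induct)
    case zero
    then show ?case using h_carrier[OF g] by (simp add: mul_zero)
  next
    case (add f f')
    then show ?case using h_carrier[OF g] by (simp add: mul_add_left h_carrier)
  next
    case (word k u)
    note u = word hw_carrier[OF word] subspace_scale[OF carrier_subspace hw_carrier[OF word]]
    show ?case using g
    proof (induction rule: words_induct)
      case zero
      then show ?case using u by (simp add: mul_zero)
    next
      case (add f f')
      then show ?case using u by (simp add: mul_add_right h_carrier)
    next
      case (word l v)
      then show ?case using u hw_carrier[OF word]
        by (simp add: mul_scale_left mul_scale_right h_wmul subspace_scale[OF carrier_subspace])
    qed
  qed
  have "superalgebra_hom smult (Zin_part X par) (zmul par) scale V mul h"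
    unfolding superalgebra_hom_def carrier_of_Zin_part
    using h_mul h_part by (auto simp: Zin_def)
  moreover have "\<forall>x\<in>X. h (gen x) = \<phi> x" by (simp add: hw_gen)
  ultimately show ?thesis by blast
qed

theorem Zin_universal_unique:
  fixes scale :: "'k::field \<Rightarrow> 'v::ab_group_add \<Rightarrow> 'v" and X :: "'x set"
  assumes "superalgebra scale V mul"
    and h: "superalgebra_hom smult (Zin_part X par) (zmul par) scale V mul h"
    and h': "superalgebra_hom smult (Zin_part X par) (zmul par) scale V mul h'"
    and gens: "\<And>x. x \<in> X \<Longrightarrow> h (gen x) = h' (gen x)"
    and f: "f \<in> Zin X"
  shows "h f = h' f"
proof -
  interpret superalgebra scale V mul by fact
  note H = h[unfolded superalgebra_hom_def carrier_of_Zin_part] h'[unfolded superalgebra_hom_def carrier_of_Zin_part]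
  have W: "(word w :: ('x, 'k) words) \<in> Zin X" if "w \<in> lists X - {[]}" for w
    using that by (simp add: Zin_def)
  have words: "h (word w) = h' (word w)" if "w \<in> lists X - {[]}" for w
    using that
  proof (induction w rule: rev_induct)
    case (snoc x w)
    show ?case
    proof (cases "w = []")
      case True
      then show ?thesis using snoc.prems gens by simp
    next
      case False
      with snoc.prems have "(word w :: ('x, 'k) words) \<in> Zin X" "(gen x :: ('x, 'k) words) \<in> Zin X" by (auto intro!: W)
      then have "h (zmul par (word w) (gen x)) = mul (h (word w)) (h (gen x))"
        "h' (zmul par (word w) (gen x)) = mul (h' (word w)) (h' (gen x))"
        using H by blast+
      moreover have "h (word w) = h' (word w)" "h (gen x) = h' (gen x)"
        using False snoc gens by auto
      ultimately have "h (zmul par (word w) (gen x)) = h' (zmul par (word w) (gen x))" by metis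
      then show ?thesis by (simp add: zmul_gen)
    qed
  qed simp
  from f have "Poly_Mapping.keys f \<subseteq> lists X - {[]}" by (simp add: Zin_def)
  then show ?thesis
  proof (induction rule: words_induct)
    case zero
    have "h (smult 0 0) = h' (smult 0 0)" using H words.subspace_0[OF subspace_Zin] by (metis scale_zero_left)
    then show ?case by simp
  next
    case (add f g)
    then have "f \<in> Zin X" "g \<in> Zin X" by (simp_all add: Zin_def)
    with H add show ?case by simp
  next
    case (word k w)
    with H W[OF word] words[OF word] show ?case by simp
  qed
qed


section \<open>The free special Tortkara superalgebra and the map \<open>p\<close>\<close>

text \<open>
  Words are homogeneous, so the superbracket is given by its defining formula on words and extended
  bilinearly; see lemma \<open>superbracket_eq\<close> for the formula on arbitrary homogeneous elements.
\<close>

definition superbracket :: "('x \<Rightarrow> bit) \<Rightarrow> ('x, 'k::field) words \<Rightarrow> ('x, 'k) words \<Rightarrow> ('x, 'k) words" where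
  "superbracket par =
     bilext (\<lambda>u v. wmul par u v - smult (koszul (wpar par u * wpar par v)) (wmul par v u))"

definition ST :: "'x set \<Rightarrow> ('x \<Rightarrow> bit) \<Rightarrow> ('x, 'k::field) words set" where
  "ST X par = generated_superalgebra smult (Zin_part X par) (superbracket par) (gen ` X)"

definition p_word :: "('x \<Rightarrow> bit) \<Rightarrow> 'x list \<Rightarrow> ('x, 'k::field) words" where
  "p_word par w =
     (case rev w of
        [] \<Rightarrow> 0
      | [x] \<Rightarrow> - word [x]
      | z # y # us \<Rightarrow> smult (koszul (par y * par z)) (word (rev us @ [z, y])))"

definition p_map :: "('x \<Rightarrow> bit) \<Rightarrow> ('x, 'k::field) words \<Rightarrow> ('x, 'k) words" where
  "p_map par = linext smult (p_word par)"

lemma superbracket_simps [simp]: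
  "superbracket par (f + f') g = superbracket par f g + superbracket par f' g"
  "superbracket par f (g + g') = superbracket par f g + superbracket par f g'"
  "superbracket par (smult k f) g = smult k (superbracket par f g)"
  "superbracket par f (smult k g) = smult k (superbracket par f g)"
  "superbracket par 0 g = 0"
  "superbracket par f 0 = 0"
  "superbracket par (word u) (word v) =
    wmul par u v - smult (koszul (wpar par u * wpar par v)) (wmul par v u)"
  by (simp_all add: superbracket_def)

lemma superbracket_eq:
  assumes f: "f \<in> Zin_part X par q" and g: "g \<in> Zin_part X par r"
  shows "superbracket par f g = zmul par f g - smult (koszul (q * r)) (zmul par g f)"
  using f[unfolded Zin_part_iff]
proof (induction rule: words_induct)
  case (word k u)
  from g[unfolded Zin_part_iff]
  have "superbracket par (word u) g = zmul par (word u) g - smult (koszul (q * r)) (zmul par g (word u))"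
  proof (induction rule: words_induct)
    case (word l v)
    then show ?case using \<open>u \<in> _\<close>
      by (simp add: part_words_def words.scale_right_diff_distrib mult.commute)
  qed (simp_all add: words.scale_right_distrib add_diff_add)
  then show ?case by (simp add: words.scale_right_diff_distrib mult.commute)
qed (simp_all add: words.scale_right_distrib add_diff_add)

lemma superalgebra_superbracket:
  fixes X :: "'x set"
  shows "superalgebra (smult :: 'k::field \<Rightarrow> ('x, 'k) words \<Rightarrow> _) (Zin_part X par) (superbracket par)"
proof
  fix f g :: "('x, 'k) words" and q r
  assume "f \<in> Zin_part X par q" "g \<in> Zin_part X par r"
  then show "superbracket par f g \<in> Zin_part X par (q + r)"
    using zmul_in_Zin_part[of f X par q g r] zmul_in_Zin_part[of g X par r f q]
    by (simp add: superbracket_eq words.subspace_diff[OF subspace_Zin_part] Zin_part_smult add.commute)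
qed (simp_all add: subspace_Zin_part Zin_part_direct)

lemma sub_superalgebra_ST:
  fixes X :: "'x set"
  shows "sub_superalgebra (smult :: 'k::field \<Rightarrow> ('x, 'k) words \<Rightarrow> _)
      (Zin_part X par) (superbracket par) (ST X par)"
    and "gen ` X \<subseteq> (ST X par :: ('x, 'k) words set)"
    and "ST X par \<subseteq> (Zin X :: ('x, 'k) words set)"
proof -
  interpret superalgebra "smult :: 'k \<Rightarrow> ('x, 'k) words \<Rightarrow> _" "Zin_part X par" "superbracket par"
    by (rule superalgebra_superbracket)
  have "(gen x :: ('x, 'k) words) \<in> Zin X" if "x \<in> X" for x
    using that by (simp add: Zin_def)
  then have G: "gen ` X \<subseteq> carrier_of (Zin_part X par :: bit \<Rightarrow> ('x, 'k) words set)"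
    by (auto simp: carrier_of_Zin_part)
  show "sub_superalgebra (smult :: 'k \<Rightarrow> ('x, 'k) words \<Rightarrow> _)
      (Zin_part X par) (superbracket par) (ST X par)"
    unfolding ST_def using G by (rule sub_superalgebra_generated)
  show "gen ` X \<subseteq> (ST X par :: ('x, 'k) words set)"
    by (auto simp: ST_def generated_superalgebra_def)
  show "ST X par \<subseteq> (Zin X :: ('x, 'k) words set)"
    using generated_subset_carrier[OF G] by (simp add: ST_def carrier_of_Zin_part)
qed

lemma p_map_left_bracketed:
  "p_map par (gen x) = - gen x"
  "p_map par (left_bracketed par x [y]) = smult (koszul (par x * par y)) (left_bracketed par y [x])"
  "p_map par (left_bracketed par x (xs @ [y, z])) =
     smult (koszul (par y * par z)) (left_bracketed par x (xs @ [z, y]))"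
  by (simp_all add: p_map_def p_word_def left_bracketed_eq_word)

end

(*
  Write u.y for the word u followed by y, all signs being suppressed, and T = 1 + p.  For words
  a = a'.t.y and b = b'.z.x one has a o b = (a sh b'.z).x with the shuffle product sh.  Hence, up to
  words on which T vanishes, [a, b] is (a sh b').z.x - (b sh a').t.y, so T[a, b] is expressed through
  Ta and Tb, and the kernel of T is closed under the bracket.

  Conversely, the kernel of T is spanned by the elements u.(y.z - z.y).  It suffices to show, by
  induction on the length k of c, that C.c.(y.z - z.y) lies in ST for every C in ST.
  The identity [a,[b,C]] - [b,[a,C]] = 2 ((C o b) o a - (C o a) o b) gives the case k = 0 when a, b are
  generators, and gives a cyclic linear system for C.x.(y.z - z.y) when b = [y, z].
  For k >= 2 the induction hypothesis makes C.c.(y.z - z.y) symmetric in the letters of c modulo ST;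
  bracketing a generator x with C.c'.(y.z - z.y), where c' has length k - 1, then yields the cyclic
  system (k + 1) A(x,y,z) = A(y,z,x) + A(z,x,y) for A(x,y,z) = C.x.c'.(y.z - z.y), which is
  nonsingular for k >= 2 (but not for k = 1).
*)

theory Submission
  imports Defs
begin

section \<open>Linearity and sign rules\<close>

lemma smult_minus_one [simp]: "smult (- 1) f = - f"
  using words.scale_minus_left[of 1 f] by simp

lemma snoc_minus [simp]: "snoc x (- f) = - snoc x f"
  using snoc_simps(2)[of x "- 1" f] by (simp del: snoc_simps)

lemma koszul_times_koszul [simp]: "koszul b * koszul b = (1 :: 'k::ring_1)"
  by (simp add: koszul_def)

lemma superbracket_diff [simp]:
  "superbracket par (f - f') g = superbracket par f g - superbracket par f' g"
  "superbracket par f (g - g') = superbracket par f g - superbracket par f g'"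
  using superbracket_simps(1)[of par "f - f'" f' g] superbracket_simps(2)[of par f "g - g'" g']
  by (simp_all del: superbracket_simps add: eq_diff_eq)

lemma scale_two: "smult 2 f = f + f"
  using words.scale_left_distrib[of 1 1 f] by simp

section \<open>Elements of \<open>ST\<close> are skew under \<open>p\<close>\<close>

text \<open>The super shuffle product, obtained by supersymmetrizing \<open>wmul\<close>. The empty
  word is its unit; two empty words need their own clause because \<open>wmul\<close> has the dummy
  value 0 there.\<close>

definition shuffle :: "('x \<Rightarrow> bit) \<Rightarrow> 'x list \<Rightarrow> 'x list \<Rightarrow> ('x, 'k::field) words" where
  "shuffle par u v =
     (if u = [] \<and> v = [] then word []
      else wmul par u v + smult (koszul (wpar par u * wpar par v)) (wmul par v u))"

lemma wmul_Nil_right [simp]: "wmul par u [] = 0"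
  by (subst wmul.simps) simp

lemma wmul_Nil_left: "v \<noteq> [] \<Longrightarrow> wmul par [] v = word v"
proof (induction v rule: rev_induct)
  case (snoc x v)
  then show ?case
    by (cases "v = []") (simp_all add: wmul_snoc)
qed simp

lemma shuffle_Nil [simp]: "shuffle par [] v = word v" "shuffle par u [] = word u"
  by (simp_all add: shuffle_def wmul_Nil_left)

lemma shuffle_commute:
  "shuffle par v u = smult (koszul (wpar par u * wpar par v)) (shuffle par u v)"
  by (auto simp: shuffle_def words.scale_right_distrib mult.commute add.commute)

text \<open>In a Zinbiel product the last letter of the right factor stays last, and all other
  letters are shuffled. This form of the recursion also covers empty words.\<close>

lemma wmul_snoc_shuffle: "wmul par u (v @ [x]) = snoc x (shuffle par u v)"
  by (cases "v = []"; cases "u = []") (simp_all add: wmul_snoc wmul_Nil_left shuffle_def)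

section \<open>The operator T = 1 + p on products and brackets\<close>

lemma p_map_simps [simp]:
  "p_map par (f + g) = p_map par f + p_map par g"
  "p_map par (smult k f) = smult k (p_map par f)"
  "p_map par 0 = 0"
  "p_map par (word w) = p_word par w"
  by (simp_all add: p_map_def)

lemma p_map_diff [simp]: "p_map par (f - g) = p_map par f - p_map par g"
  using p_map_simps(1)[of par "f - g" g] by (simp del: p_map_simps add: eq_diff_eq)

lemma p_map_snoc_snoc:
  "p_map par (snoc z (snoc y f)) = smult (koszul (par y * par z)) (snoc y (snoc z f))"
proof -
  have "Poly_Mapping.keys f \<subseteq> UNIV" by simp
  then show ?thesis
    by (induction rule: words_induct)
      (simp_all add: words.scale_right_distrib p_word_def mult.commute)
qed

text \<open>The operator T of the overview: its kernel is the set of f with p(f) = -f. Since p(x) =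
  -x on generators, it contains them.\<close>

definition skew_defect :: "('x \<Rightarrow> bit) \<Rightarrow> ('x, 'k::field) words \<Rightarrow> ('x, 'k) words" where
  "skew_defect par f = f + p_map par f"

lemma skew_defect_simps [simp]:
  "skew_defect par (f + g) = skew_defect par f + skew_defect par g"
  "skew_defect par (f - g) = skew_defect par f - skew_defect par g"
  "skew_defect par (smult k f) = smult k (skew_defect par f)"
  "skew_defect par 0 = 0"
  "skew_defect par (gen x) = 0"
  by (simp_all add: skew_defect_def words.scale_right_distrib p_word_def)

lemma skew_defect_snoc_snoc:
  "skew_defect par (snoc z (snoc y f)) =
     snoc z (snoc y f) + smult (koszul (par y * par z)) (snoc y (snoc z f))"
  by (simp add: skew_defect_def p_map_snoc_snoc)

text \<open>T symmetrizes the last two letters, so exchanging them beforehand costs only a sign.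
  This is what cancels the cross terms of a bracket.\<close>

lemma skew_defect_snoc_snoc_swap:
  "skew_defect par (snoc y (snoc z f)) =
     smult (koszul (par y * par z)) (skew_defect par (snoc z (snoc y f)))"
  by (simp add: skew_defect_snoc_snoc words.scale_right_distrib mult.commute add.commute)

text \<open>The words of \<open>u \<circ> v\<close> whose last two letters are the last two letters of \<open>v\<close>.\<close>

definition wmul_tail :: "('x \<Rightarrow> bit) \<Rightarrow> 'x list \<Rightarrow> 'x list \<Rightarrow> ('x, 'k::field) words" where
  "wmul_tail par u v = (if length v < 2 then 0 else snoc (last v) (wmul par u (butlast v)))"

lemma wmul_tail_simps [simp]:
  "wmul_tail par u [x] = 0"
  "wmul_tail par u (v @ [y, z]) = snoc z (snoc y (shuffle par u v))"
  by (simp_all add: wmul_tail_def butlast_append wmul_snoc_shuffle flip: append_assoc)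

text \<open>All words of the product end in \<open>x\<close>. The letter before \<open>x\<close> is
  either the last letter of \<open>v\<close>, which gives the tail, or \<open>y\<close>, which
  leaves \<open>u\<close> and \<open>v\<close> to be shuffled in front.\<close>

lemma wmul_eq_tail:
  "(wmul par (u @ [y]) (v @ [x]) :: ('x, 'k::field) words) = wmul_tail par (u @ [y]) (v @ [x]) +
     smult (koszul (wpar par (u @ [y]) * wpar par v)) (snoc x (snoc y (shuffle par v u)))"
proof (cases v rule: rev_cases)
  case Nil
  then show ?thesis by simp
next
  case (snoc v' z)
  have "(wmul par (u @ [y]) (v @ [x]) :: ('x, 'k) words) = snoc x (shuffle par (u @ [y]) v)"
    by (rule wmul_snoc_shuffle)
  also have "(shuffle par (u @ [y]) v :: ('x, 'k) words) = wmul par (u @ [y]) (v' @ [z]) +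
      smult (koszul (wpar par (u @ [y]) * wpar par v)) (wmul par v (u @ [y]))"
    by (simp add: shuffle_def snoc)
  finally show ?thesis
    by (simp add: wmul_snoc_shuffle snoc)
qed

lemma skew_defect_superbracket_words:
  "skew_defect par (superbracket par (word (u @ [y])) (word (v @ [x]))) =
     skew_defect par (wmul_tail par (u @ [y]) (v @ [x])) -
     smult (koszul (wpar par (u @ [y]) * wpar par (v @ [x])))
       (skew_defect par (wmul_tail par (v @ [x]) (u @ [y])))"
proof -
  \<comment> \<open>The non-tail words of the two products end in \<open>y\<close>, \<open>x\<close>
    and in \<open>x\<close>, \<open>y\<close>, after the same shuffle up to sign, so their images
    under T cancel in the bracket.\<close>
  have "skew_defect par (smult (koszul (wpar par (u @ [y]) * wpar par v)) (snoc x (snoc y (shuffle par v u)))) =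
    smult (koszul (wpar par (u @ [y]) * wpar par (v @ [x])))
     (skew_defect par (smult (koszul (wpar par (v @ [x]) * wpar par u)) (snoc y (snoc x (shuffle par u v)))))"
    unfolding skew_defect_simps shuffle_commute[of par v u] skew_defect_snoc_snoc_swap[of par y x] snoc_simps
    by (cases "par x"; cases "par y"; cases "wpar par u"; cases "wpar par v") simp_all
  then show ?thesis
    by (simp add: wmul_eq_tail words.scale_right_distrib words.scale_right_diff_distrib
         del: words.scale_scale)
qed

lemma skew_defect_word:
  "skew_defect par (word (v @ [y, z])) =
    word (v @ [y, z]) + smult (koszul (par y * par z)) (word (v @ [z, y]))"
  by (simp add: skew_defect_def p_word_def)

text \<open>The last two letters of \<open>v\<close> stay at the end of every tail word, and T acts
  only on them. For a one-letter \<open>v\<close> both sides vanish.\<close>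

lemma skew_defect_wmul_tail:
  assumes "v \<noteq> []"
  shows "skew_defect par (wmul_tail par u v) = bilext (wmul_tail par) (word u) (skew_defect par (word v))"
proof (cases "\<exists>v' y z. v = v' @ [y, z]")
  case True
  then obtain v' y z where v: "v = v' @ [y, z]" by blast
  show ?thesis
    unfolding v by (simp add: skew_defect_word skew_defect_snoc_snoc)
next
  case False
  have "\<exists>x. v = [x]"
  proof (cases v rule: rev_cases)
    case (snoc v' z)
    with False show ?thesis by (cases v' rule: rev_cases) auto
  qed (use assms in simp)
  then show ?thesis by auto
qed

text \<open>T[f, g] depends linearly on Tf and Tg, so the kernel of T is closed under the bracket.
  The sign sits inside the second bilinear map because \<open>f\<close> and \<open>g\<close> need
  not be homogeneous.\<close>

lemma skew_defect_superbracket: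
  fixes f g :: "('x, 'k::field) words"
  assumes f: "f \<in> Zin X" and g: "g \<in> Zin X"
  shows "skew_defect par (superbracket par f g) =
    bilext (wmul_tail par) f (skew_defect par g) -
    bilext (\<lambda>u v. smult (koszul (wpar par u * wpar par v)) (wmul_tail par v u)) (skew_defect par f) g"
proof -
  let ?M = "\<lambda>u v. smult (koszul (wpar par u * wpar par v)) (wmul_tail par v u)"
  have words: "skew_defect par (superbracket par (word u) (word v)) = (
    bilext (wmul_tail par) (word u) (skew_defect par (word v)) -
    bilext ?M (skew_defect par (word u)) (word v) :: ('x, 'k) words)"
    if ne: "u \<noteq> []" "v \<noteq> []" for u v
  proof -
    \<comment> \<open>T permutes letters only, so every word of Tu has the parity of
      \<open>u\<close> and the sign can be taken inside.\<close>
    have "(smult (koszul (wpar par u * wpar par v)) (bilext (wmul_tail par) (word v) (skew_defect par (word u))) :: ('x, 'k) words)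
      = bilext ?M (skew_defect par (word u)) (word v)"
    proof (cases "\<exists>u' y z. u = u' @ [y, z]")
      case True
      then obtain u' y z where u: "u = u' @ [y, z]" by blast
      show ?thesis
        unfolding u skew_defect_word by (simp add: words.scale_right_distrib ac_simps)
    next
      case False
      have "\<exists>x. u = [x]"
      proof (cases u rule: rev_cases)
        case (snoc u' z)
        with False show ?thesis by (cases u' rule: rev_cases) auto
      qed (use ne in simp)
      then show ?thesis by auto
    qed
    moreover obtain u' y v' x where "u = u' @ [y]" "v = v' @ [x]"
      using ne by (metis rev_exhaust)
    then have "(skew_defect par (superbracket par (word u) (word v)) :: ('x, 'k) words) =
        skew_defect par (wmul_tail par u v) -
        smult (koszul (wpar par u * wpar par v)) (skew_defect par (wmul_tail par v u))"
      by (simp only: skew_defect_superbracket_words)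
    ultimately show ?thesis
      by (simp only: skew_defect_wmul_tail[OF ne(1)] skew_defect_wmul_tail[OF ne(2)])
  qed
  from f have "Poly_Mapping.keys f \<subseteq> lists X - {[]}" by (simp add: Zin_def)
  then show ?thesis
  proof (induction rule: words_induct)
    case (word k u)
    from g have "Poly_Mapping.keys g \<subseteq> lists X - {[]}" by (simp add: Zin_def)
    then show ?case
    proof (induction rule: words_induct)
      case (word l v)
      with \<open>u \<in> _\<close> words[of u v] show ?case
        by (simp add: words.scale_right_diff_distrib mult.commute del: superbracket_simps(7))
    qed (simp_all add: words.scale_right_distrib add_diff_add)
  qed (simp_all add: add_diff_add)
qed

section \<open>The kernel of T as a graded subalgebra\<close>

lemma p_map_in_Zin_part:
  assumes "f \<in> Zin_part X par q"
  shows "p_map par f \<in> Zin_part X par q"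
  using assms[unfolded Zin_part_iff]
proof (induction rule: words_induct)
  case (word k w)
  then obtain v z where w: "w = v @ [z]"
    unfolding part_words_def
    by (metis (no_types, lifting) mem_Collect_eq DiffD2 insertCI rev_exhaust)
  show ?case
  proof (cases v rule: rev_cases)
    case Nil
    with w word have "smult (- k) (word w) \<in> Zin_part X par q"
      by (intro Zin_part_smult word_in_Zin_part)
    with w Nil show ?thesis by (simp add: p_word_def)
  next
    case (snoc u y)
    with w word have "u @ [z, y] \<in> part_words X par q" by (auto simp: part_words_def add_ac)
    then have "smult k (smult (koszul (par y * par z)) (word (u @ [z, y]))) \<in> Zin_part X par q"
      by (intro Zin_part_smult word_in_Zin_part)
    with w snoc show ?thesis by (simp add: p_word_def del: words.scale_scale)
  qed
qed (simp_all add: Zin_part_add)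

lemma p_map_ST:
  fixes X :: "'x set" and f :: "('x, 'k::field) words"
  assumes "f \<in> ST X par"
  shows "p_map par f = - f"
proof -
  interpret superalgebra "smult :: 'k \<Rightarrow> ('x, 'k) words \<Rightarrow> _" "Zin_part X par" "superbracket par"
    by (rule superalgebra_superbracket)
  define S :: "('x, 'k) words set" where "S = {f \<in> Zin X. skew_defect par f = 0}"
  have sub: "words.subspace S"
    unfolding words.subspace_def S_def
    using subspace_Zin[of X] by (auto simp: words.subspace_def)
  have "f \<in> carrier_of (\<lambda>q. S \<inter> Zin_part X par q)" if f: "f \<in> S" for f
  proof -
    from f have "f \<in> carrier_of (Zin_part X par)" by (simp add: S_def carrier_of_Zin_part)
    then obtain a b where ab: "f = a + b" "a \<in> Zin_part X par 0" "b \<in> Zin_part X par 1"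
      by (rule carrier_of_E)
    \<comment> \<open>T preserves parity, so Ta and Tb are the even and odd parts of Tf = 0 and
      vanish separately.\<close>
    have "skew_defect par a \<in> Zin_part X par 0" "skew_defect par b \<in> Zin_part X par 1"
      using ab by (simp_all add: skew_defect_def Zin_part_add p_map_in_Zin_part)
    moreover have "skew_defect par a + skew_defect par b = 0 + 0"
      using f ab(1) by (simp add: S_def)
    ultimately have "skew_defect par a = 0" "skew_defect par b = 0"
      using part_unique[of "skew_defect par a" "skew_defect par b" 0 0] by auto
    with ab have "a \<in> S \<inter> Zin_part X par 0" "b \<in> S \<inter> Zin_part X par 1"
      by (auto simp: S_def Zin_part_def)
    with ab(1) show ?thesis by (auto intro: carrier_of_I)
  qed
  moreover have "carrier_of (\<lambda>q. S \<inter> Zin_part X par q) \<subseteq> S"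
    using words.subspace_add[OF sub] by (auto simp: carrier_of_def)
  moreover have "superbracket par f g \<in> S" if "f \<in> S" "g \<in> S" for f g
  proof -
    from that have fg: "f \<in> Zin X" "g \<in> Zin X" "skew_defect par f = 0" "skew_defect par g = 0"
      by (simp_all add: S_def)
    then have "superbracket par f g \<in> Zin X"
      using mul_carrier[of f g] by (simp add: carrier_of_Zin_part)
    with fg show ?thesis
      by (simp add: S_def skew_defect_superbracket)
  qed
  ultimately have "sub_superalgebra smult (Zin_part X par) (superbracket par) S"
    using sub unfolding sub_superalgebra_def by blast
  moreover have "gen ` X \<subseteq> S" by (auto simp: S_def Zin_def)
  ultimately have "ST X par \<subseteq> S"
    unfolding ST_def generated_superalgebra_def by blast
  with assms show ?thesis by (auto simp: S_def skew_defect_def add_eq_0_iff)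
qed

section \<open>Skew elements lie in \<open>ST\<close>\<close>

text \<open>Once the Zinbiel identity has made all products left-bracketed, (ab)c, (ba)c, (ac)b and
  (bc)a cancel, while (cb)a and (ca)b occur twice.\<close>

lemma superbracket_nested_diff:
  assumes a: "a \<in> Zin_part X par q" and b: "b \<in> Zin_part X par r" and c: "c \<in> Zin_part X par t"
  shows "superbracket par a (superbracket par b c) -
      smult (koszul (q * r)) (superbracket par b (superbracket par a c)) =
    smult (2 * koszul (q * r + q * t + r * t)) (zmul par (zmul par c b) a -
      smult (koszul (q * r)) (zmul par (zmul par c a) b))"
proof -
  note br = zmul_in_Zin_part[OF b c] zmul_in_Zin_part[OF c b] zmul_in_Zin_part[OF a c] zmul_in_Zin_part[OF c a]
  have abc: "superbracket par a (superbracket par b c) =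
     zmul par a (zmul par b c) - smult (koszul (q * (r + t))) (zmul par (zmul par b c) a) -
     smult (koszul (r * t)) (zmul par a (zmul par c b) - smult (koszul (q * (r + t))) (zmul par (zmul par c b) a))"
    using superbracket_eq[OF a br(1)] superbracket_eq[OF a br(2)]
    by (simp add: superbracket_eq[OF b c] superbracket_diff add.commute[of t r])
  have bac: "superbracket par b (superbracket par a c) =
     zmul par b (zmul par a c) - smult (koszul (r * (q + t))) (zmul par (zmul par a c) b) -
     smult (koszul (q * t)) (zmul par b (zmul par c a) - smult (koszul (r * (q + t))) (zmul par (zmul par c a) b))"
    using superbracket_eq[OF b br(3)] superbracket_eq[OF b br(4)]
    by (simp add: superbracket_eq[OF a c] superbracket_diff add.commute[of t q])
  interpret zinbiel_superalgebra smult "Zin_part X par" "zmul par"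
    by (rule zinbiel_Zin)
  show ?thesis
    unfolding abc bac zinbiel[OF a b c] zinbiel[OF a c b] zinbiel[OF b a c] zinbiel[OF b c a]
    by (cases q; cases r; cases t)
      (simp_all add: words.scale_right_distrib words.scale_right_diff_distrib algebra_simps scale_two)
qed

lemma subspace_ST: "words.subspace (ST X par)"
  using sub_superalgebra_ST(1) unfolding sub_superalgebra_def by blast

lemmas ST_add = words.subspace_add[OF subspace_ST]
  and ST_diff = words.subspace_diff[OF subspace_ST]
  and ST_smult = words.subspace_scale[OF subspace_ST]
  and ST_zero = words.subspace_0[OF subspace_ST]

lemma ST_superbracket: "f \<in> ST X par \<Longrightarrow> g \<in> ST X par \<Longrightarrow> superbracket par f g \<in> ST X par"
  using sub_superalgebra_ST(1)[of X par] unfolding sub_superalgebra_def by blast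

lemma ST_gen: "x \<in> X \<Longrightarrow> gen x \<in> ST X par"
  using sub_superalgebra_ST(2)[of X par] by blast

lemma ST_smultD:
  assumes "smult k f \<in> ST X par" "k \<noteq> 0"
  shows "f \<in> ST X par"
  using ST_smult[OF assms(1), of "inverse k"] assms(2) by simp

lemma gen_in_Zin_part: "x \<in> X \<Longrightarrow> gen x \<in> Zin_part X par (par x)"
  by (auto intro!: word_in_Zin_part simp: part_words_def)

lemma superbracket_in_Zin_part:
  "f \<in> Zin_part X par q \<Longrightarrow> g \<in> Zin_part X par r \<Longrightarrow> superbracket par f g \<in> Zin_part X par (q + r)"
  by (rule superalgebra.mul_graded[OF superalgebra_superbracket])

text \<open>Twice this element is, up to sign, a difference of nested brackets; dividing by 2 uses
  the characteristic.\<close>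

lemma ternary_in_ST:
  fixes c :: "('x, 'k::field_char_0) words"
  assumes "a \<in> ST X par" "b \<in> ST X par" "c \<in> ST X par"
    and "a \<in> Zin_part X par q" "b \<in> Zin_part X par r" "c \<in> Zin_part X par t"
  shows "zmul par (zmul par c b) a - smult (koszul (q * r)) (zmul par (zmul par c a) b) \<in> ST X par"
proof (rule ST_smultD)
  show "smult (2 * koszul (q * r + q * t + r * t)) (zmul par (zmul par c b) a -
      smult (koszul (q * r)) (zmul par (zmul par c a) b)) \<in> ST X par"
    unfolding superbracket_nested_diff[OF assms(4-6), symmetric]
    by (intro ST_diff ST_smult ST_superbracket assms)
qed (simp add: koszul_def)

section \<open>Alternating two final letters: none or one letter in between\<close>

text \<open>The element f.(y.z - z.y) of the overview with its sign; for a word f it is the image of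
  f.y.z under 1 - p.\<close>

definition alt :: "('x \<Rightarrow> bit) \<Rightarrow> 'x \<Rightarrow> 'x \<Rightarrow> ('x, 'k::field) words \<Rightarrow> ('x, 'k) words" where
  "alt par y z f = snoc z (snoc y f) - smult (koszul (par y * par z)) (snoc y (snoc z f))"

lemma alt_simps [simp]:
  "alt par y z (f + g) = alt par y z f + alt par y z g"
  "alt par y z (f - g) = alt par y z f - alt par y z g"
  "alt par y z (smult k f) = smult k (alt par y z f)"
  "alt par y z (- f) = - alt par y z f"
  by (simp_all add: alt_def words.scale_right_distrib words.scale_right_diff_distrib mult.commute)

lemma alt_in_Zin_part:
  assumes "f \<in> Zin_part X par q" "y \<in> X" "z \<in> X"
  shows "alt par y z f \<in> Zin_part X par (q + par y + par z)"
proof -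
  have "snoc y (snoc z f) \<in> Zin_part X par (q + par y + par z)"
    using snoc_in_Zin_part[OF snoc_in_Zin_part[OF assms(1,3)] assms(2)] by (simp add: add_ac)
  then show ?thesis
    unfolding alt_def
    by (intro words.subspace_diff[OF subspace_Zin_part] Zin_part_smult snoc_in_Zin_part assms)
qed

lemma fold_snoc_simps [simp]:
  "fold snoc w (f + g) = fold snoc w f + fold snoc w g"
  "fold snoc w (f - g) = fold snoc w f - fold snoc w g"
  "fold snoc w (smult k f) = smult k (fold snoc w f)"
  "fold snoc w (- f) = - fold snoc w f"
  by (induction w arbitrary: f g) simp_all

lemma fold_snoc_word: "fold snoc w (word u) = word (u @ w)"
  by (induction w arbitrary: u) simp_all

lemma fold_snoc_in_Zin_part:
  "f \<in> Zin_part X par q \<Longrightarrow> set w \<subseteq> X \<Longrightarrow> fold snoc w f \<in> Zin_part X par (q + wpar par w)"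
proof (induction w arbitrary: f q)
  case (Cons x w)
  then show ?case
    using Cons.IH[of "snoc x f" "q + par x"] by (simp add: snoc_in_Zin_part add.assoc)
qed simp

lemma alt_in_ST:
  fixes C :: "('x, 'k::field_char_0) words"
  assumes "C \<in> ST X par" "C \<in> Zin_part X par q" "y \<in> X" "z \<in> X"
  shows "alt par y z C \<in> ST X par"
  using ternary_in_ST[of "gen z" X par "gen y" C "par z" "par y" q] assms
  by (simp add: ST_gen gen_in_Zin_part zmul_gen alt_def mult.commute)

text \<open>For C in ST this moves a left generator to the right end modulo ST.\<close>

lemma zmul_gen_left:
  assumes "C \<in> Zin_part X par q" "y \<in> X"
  shows "zmul par (gen y) C = superbracket par (gen y) C + smult (koszul (par y * q)) (snoc y C)"
  using superbracket_eq[OF gen_in_Zin_part[OF assms(2)] assms(1)] by (simp add: zmul_gen)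

lemma zmul_superbracket_gens:
  assumes f: "f \<in> Zin_part X par q" and "y \<in> X" "z \<in> X"
  shows "zmul par f (superbracket par (gen y) (gen z)) =
    alt par y z f + smult (koszul (q * par y)) (snoc z (zmul par (gen y) f)) -
    smult (koszul (par y * par z + q * par z)) (snoc y (zmul par (gen z) f))"
proof -
  have "zmul par f (word [y, z]) = snoc z (snoc y f + smult (koszul (q * par y)) (zmul par (gen y) f))"
    if "y \<in> X" for y z
    using zmul_snoc[OF f gen_in_Zin_part[OF that], of z] by (simp add: zmul_gen)
  with assms(2,3) show ?thesis
    by (cases q; cases "par y"; cases "par z") (simp_all add: alt_def words.scale_right_diff_distrib words.scale_right_distrib)
qed

text \<open>The ternary operation is applied to C, v and [y, z]. The result is the stated
  combination plus alternated pairs following [y, C] and [z, C], which lie in ST by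
  \<open>alt_in_ST\<close>.\<close>

lemma alt_snoc_relation:
  fixes C :: "('x, 'k::field_char_0) words"
  assumes C: "C \<in> ST X par" "C \<in> Zin_part X par q" and v: "v \<in> X" and y: "y \<in> X" and z: "z \<in> X"
  shows "alt par y z (snoc v C) - smult (2 * koszul (par v * (par y + par z))) (alt par z v (snoc y C)) -
    smult (2 * koszul (par z * (par v + par y))) (alt par v y (snoc z C)) \<in> ST X par"
    (is "?t \<in> _")
proof -
  let ?b = "superbracket par (gen y) (gen z)"
  let ?Y = "superbracket par (gen y) C" and ?Z = "superbracket par (gen z) C"
  have "zmul par (zmul par C (gen v)) ?b -
      smult (koszul ((par y + par z) * par v)) (zmul par (zmul par C ?b) (gen v)) \<in> ST X par"
    by (intro ternary_in_ST[where t = q] ST_superbracket ST_gen superbracket_in_Zin_part gen_in_Zin_part assms)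
  moreover have "alt par v z ?Y \<in> ST X par"
    by (intro alt_in_ST[where q = "par y + q"] ST_superbracket ST_gen superbracket_in_Zin_part
        gen_in_Zin_part assms)
  moreover have "alt par v y ?Z \<in> ST X par"
    by (intro alt_in_ST[where q = "par z + q"] ST_superbracket ST_gen superbracket_in_Zin_part
        gen_in_Zin_part assms)
  ultimately have "zmul par (zmul par C (gen v)) ?b -
      smult (koszul ((par y + par z) * par v)) (zmul par (zmul par C ?b) (gen v))
      - smult (koszul (par y * (q + par v))) (alt par v z ?Y)
      + smult (koszul (par z * (q + par v + par y))) (alt par v y ?Z) \<in> ST X par"
    by (intro ST_add[OF ST_diff] ST_smult)
  moreover have "zmul par (zmul par C (gen v)) ?b -
      smult (koszul ((par y + par z) * par v)) (zmul par (zmul par C ?b) (gen v))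
      - smult (koszul (par y * (q + par v))) (alt par v z ?Y)
      + smult (koszul (par z * (q + par v + par y))) (alt par v y ?Z) = ?t"
  proof -
    have vC: "snoc v C \<in> Zin_part X par (q + par v)"
      by (rule snoc_in_Zin_part[OF C(2) v])
    \<comment> \<open>Both summands of (x o C + C o x).v contribute C.x.v modulo [x, C].v, hence the
      factor 2.\<close>
    have *: "zmul par (gen x) (snoc v C) =
        snoc v (superbracket par (gen x) C) + smult (2 * koszul (par x * q)) (snoc v (snoc x C))"
      if "x \<in> X" for x
      using zmul_snoc[OF gen_in_Zin_part[OF that, of par] C(2), of v]
      by (simp add: zmul_gen zmul_gen_left[OF C(2) that] scale_two flip: words.scale_scale)
    show ?thesis
      unfolding zmul_gen zmul_superbracket_gens[OF vC y z] zmul_superbracket_gens[OF C(2) y z]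
        zmul_gen_left[OF C(2) y] zmul_gen_left[OF C(2) z] *[OF y] *[OF z]
      by (rule poly_mapping_eqI, cases q; cases "par v"; cases "par y"; cases "par z")
        (simp_all add: alt_def lookup_add lookup_minus lookup_smult)
  qed
  ultimately show ?thesis by (simp only:)
qed

text \<open>The signs are those of a cyclic system \<open>\<kappa> a - b' - c', \<kappa> b' - c' - a, \<kappa> c' - a - b'\<close>,
  whose matrix has eigenvalues \<open>\<kappa> + 1\<close> and \<open>\<kappa> - 2\<close>, in \<open>b' = \<plusminus>b\<close> and \<open>c' = \<plusminus>c\<close>.\<close>

lemma cyclic_system:
  fixes a b c :: "('x, 'k::field_char_0) words"
  assumes "s * s = 1" "t * t = 1"
    and "smult \<kappa> a - smult s b - smult t c \<in> ST X par"
    and "smult \<kappa> b - smult (s * t) c - smult s a \<in> ST X par"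
    and "smult \<kappa> c - smult t a - smult (s * t) b \<in> ST X par"
    and \<kappa>: "\<kappa> \<noteq> - 1" "\<kappa> \<noteq> 2"
  shows "a \<in> ST X par"
proof (rule ST_smultD)
  \<comment> \<open>The multipliers are proportional to a row of the adjugate matrix, so
    \<open>b\<close> and \<open>c\<close> drop out.\<close>
  have "smult (\<kappa> - 1) (smult \<kappa> a - smult s b - smult t c) +
      smult s (smult \<kappa> b - smult (s * t) c - smult s a) +
      smult t (smult \<kappa> c - smult t a - smult (s * t) b) \<in> ST X par"
    by (intro ST_add ST_smult assms)
  moreover have "smult (\<kappa> - 1) (smult \<kappa> a - smult s b - smult t c) +
      smult s (smult \<kappa> b - smult (s * t) c - smult s a) +
      smult t (smult \<kappa> c - smult t a - smult (s * t) b) = smult ((\<kappa> - 2) * (\<kappa> + 1)) a"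
  proof (rule poly_mapping_eqI)
    fix w
    have "(\<kappa> - 1) * (\<kappa> * A - s * B - t * C) + s * (\<kappa> * B - s * t * C - s * A) +
        t * (\<kappa> * C - t * A - s * t * B) = (\<kappa> - 2) * (\<kappa> + 1) * A" for A B C
      using assms(1,2) by algebra
    then show "Poly_Mapping.lookup (smult (\<kappa> - 1) (smult \<kappa> a - smult s b - smult t c) +
      smult s (smult \<kappa> b - smult (s * t) c - smult s a) +
      smult t (smult \<kappa> c - smult t a - smult (s * t) b)) w =
      Poly_Mapping.lookup (smult ((\<kappa> - 2) * (\<kappa> + 1)) a) w"
      by (simp only: lookup_add lookup_minus lookup_smult)
  qed
  ultimately show "smult ((\<kappa> - 2) * (\<kappa> + 1)) a \<in> ST X par"
    by (simp only:)
  show "(\<kappa> - 2) * (\<kappa> + 1) \<noteq> 0" using \<kappa> by (simp add: eq_neg_iff_add_eq_0)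
qed

text \<open>\<open>b\<close> is the parity of a block c between the first letter and the alternated
  pair. The signs are those of rearranging x.c.y.z into y.c.z.x and z.c.x.y, so they are compatible
  with cyclic rotation.\<close>

lemma cyclic_in_ST:
  fixes F :: "'x \<Rightarrow> 'x \<Rightarrow> 'x \<Rightarrow> ('x, 'k::field_char_0) words"
  assumes rel: "\<And>x y z. \<lbrakk>x \<in> X; y \<in> X; z \<in> X\<rbrakk> \<Longrightarrow> smult \<kappa> (F x y z) -
      smult (koszul (par x * (b + par y + par z) + b * par y)) (F y z x) -
      smult (koszul (par z * (b + par x + par y) + b * par x)) (F z x y) \<in> ST X par"
    and \<kappa>: "\<kappa> \<noteq> - 1" "\<kappa> \<noteq> 2" and X: "x \<in> X" "y \<in> X" "z \<in> X"
  shows "F x y z \<in> ST X par"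
proof (rule cyclic_system[OF _ _ _ _ _ \<kappa>])
  let ?s = "koszul (par x * (b + par y + par z) + b * par y) :: 'k"
    and ?t = "koszul (par z * (b + par x + par y) + b * par x) :: 'k"
  have "?s * ?t = koszul (par y * (b + par z + par x) + b * par z)"
    by (cases b; cases "par x"; cases "par y"; cases "par z") simp_all
  with rel[OF X] rel[OF X(2,3,1)] rel[OF X(3,1,2)]
  show "smult \<kappa> (F x y z) - smult ?s (F y z x) - smult ?t (F z x y) \<in> ST X par"
    "smult \<kappa> (F y z x) - smult (?s * ?t) (F z x y) - smult ?s (F x y z) \<in> ST X par"
    "smult \<kappa> (F z x y) - smult ?t (F x y z) - smult (?s * ?t) (F y z x) \<in> ST X par"
    by (simp_all only:)
qed (rule koszul_times_koszul)+

text \<open>Halving the relation with coefficients 1, -2, -2 gives the cyclic system with \<kappa> =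
  1/2, which is nonsingular.\<close>

lemma alt_snoc_in_ST:
  fixes C :: "('x, 'k::field_char_0) words"
  assumes "C \<in> ST X par" "C \<in> Zin_part X par q" "x \<in> X" "y \<in> X" "z \<in> X"
  shows "alt par y z (snoc x C) \<in> ST X par"
proof (rule cyclic_in_ST[where F = "\<lambda>x y z. alt par y z (snoc x C)" and \<kappa> = "1 / 2" and b = 0])
  fix x y z
  assume "x \<in> X" "y \<in> X" "z \<in> X"
  from ST_smult[OF alt_snoc_relation[OF assms(1,2) this], of "1 / 2"]
  show "smult (1 / 2) (alt par y z (snoc x C)) -
      smult (koszul (par x * (0 + par y + par z) + 0 * par y)) (alt par z x (snoc y C)) -
      smult (koszul (par z * (0 + par x + par y) + 0 * par x)) (alt par x y (snoc z C)) \<in> ST X par"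
    by (simp add: words.scale_right_diff_distrib)
qed (use assms in \<open>simp_all add: field_simps\<close>)

section \<open>Rearranging the letters between C and the alternated pair, given the result for fewer
  letters\<close>

context
  fixes X :: "'x set" and par :: "'x \<Rightarrow> bit" and n :: nat
  assumes shorter: "\<And>C :: ('x, 'k::field_char_0) words. \<And>q w y z.
    \<lbrakk>C \<in> ST X par; C \<in> Zin_part X par q; set w \<subseteq> X; length w < n; y \<in> X; z \<in> X\<rbrakk>
    \<Longrightarrow> alt par y z (fold snoc w C) \<in> ST X par"
begin

text \<open>The difference is the alternated pair \<open>y\<close>, \<open>z\<close> after C'.v,
  where C' = C.u.(a.b - b.a) is in ST by \<open>shorter\<close>. As \<open>shorter\<close> holds for
  every element of ST, it applies again to C' and \<open>v\<close>.\<close>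

lemma alt_fold_snoc_transpose:
  fixes C :: "('x, 'k) words"
  assumes C: "C \<in> ST X par" "C \<in> Zin_part X par q" and w: "set (u @ a # b # v) \<subseteq> X"
    and len: "length (u @ a # v) < n" and yz: "y \<in> X" "z \<in> X"
  shows "alt par y z (fold snoc (u @ a # b # v) C) -
    smult (koszul (par a * par b)) (alt par y z (fold snoc (u @ b # a # v) C)) \<in> ST X par"
proof -
  have "alt par a b (fold snoc u C) \<in> ST X par"
    by (rule shorter[OF C]) (use w len in auto)
  moreover have "alt par a b (fold snoc u C) \<in> Zin_part X par (q + wpar par u + par a + par b)"
    by (rule alt_in_Zin_part[OF fold_snoc_in_Zin_part[OF C(2)]]) (use w in auto)
  ultimately have "alt par y z (fold snoc v (alt par a b (fold snoc u C))) \<in> ST X par"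
    by (rule shorter) (use w len yz in auto)
  then show ?thesis by (simp add: alt_def[of par a b])
qed

lemma alt_fold_snoc_move:
  fixes C :: "('x, 'k) words"
  assumes C: "C \<in> ST X par" "C \<in> Zin_part X par q" and "set (u @ a # v) \<subseteq> X"
    and "length (u @ v) < n" and y: "y \<in> X" and z: "z \<in> X"
  shows "alt par y z (fold snoc (u @ a # v) C) -
    smult (koszul (wpar par u * par a)) (alt par y z (fold snoc (a # u @ v) C)) \<in> ST X par"
  using assms(3,4)
proof (induction u arbitrary: v rule: rev_induct)
  case Nil
  then show ?case by (simp add: ST_zero)
next
  case (snoc b u)
  let ?U = "alt par y z (fold snoc (u @ b # a # v) C)"
    and ?V = "alt par y z (fold snoc (u @ a # b # v) C)"
    and ?W = "alt par y z (fold snoc (a # u @ b # v) C)"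
  have "?U - smult (koszul (par b * par a)) ?V \<in> ST X par"
    by (rule alt_fold_snoc_transpose[OF C]) (use snoc.prems y z in auto)
  moreover have "?V - smult (koszul (wpar par u * par a)) ?W \<in> ST X par"
    by (rule snoc.IH) (use snoc.prems in auto)
  ultimately have "(?U - smult (koszul (par b * par a)) ?V) +
      smult (koszul (par b * par a)) (?V - smult (koszul (wpar par u * par a)) ?W) \<in> ST X par"
    by (intro ST_add ST_smult)
  moreover have "(?U - smult (koszul (par b * par a)) ?V) +
      smult (koszul (par b * par a)) (?V - smult (koszul (wpar par u * par a)) ?W) =
      ?U - smult (koszul (wpar par (u @ [b]) * par a)) ?W"
    by (cases "par a"; cases "par b"; cases "wpar par u") (simp_all add: words.scale_right_diff_distrib)
  ultimately have "?U - smult (koszul (wpar par (u @ [b]) * par a)) ?W \<in> ST X par"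
    by (simp only:)
  then show ?case by simp
qed

text \<open>The sum a o (C.u) + C.u.a inserts \<open>a\<close> everywhere. Modulo ST every insertion
  after a letter of \<open>u\<close> can be moved next to C and counts once; the base case
  \<open>u = []\<close> counts twice, which gives the factor \<open>length u + 2\<close>.\<close>

lemma alt_fold_snoc_insert:
  fixes C :: "('x, 'k) words"
  assumes C: "C \<in> ST X par" "C \<in> Zin_part X par q" and a: "a \<in> X" and "set (u @ v) \<subseteq> X"
    and "length (u @ v) < n" and y: "y \<in> X" and z: "z \<in> X"
  shows "alt par y z (fold snoc v (zmul par (gen a) (fold snoc u C) +
        smult (koszul (par a * (q + wpar par u))) (snoc a (fold snoc u C)))) -
    smult (of_nat (length u + 2) * koszul (par a * q)) (alt par y z (fold snoc (a # u @ v) C)) \<in> ST X par"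
  using assms(4,5)
proof (induction u arbitrary: v rule: rev_induct)
  case Nil
  \<comment> \<open>a o C + C.a equals [a, C] + 2 C.a, and [a, C] is a new element of ST to which
    \<open>shorter\<close> applies.\<close>
  have "alt par y z (fold snoc v (superbracket par (gen a) C)) \<in> ST X par"
    by (rule shorter[where q = "par a + q"])
      (use Nil C a y z in \<open>simp_all add: ST_superbracket ST_gen superbracket_in_Zin_part gen_in_Zin_part\<close>)
  then show ?case
    by (simp add: zmul_gen_left[OF C(2) a] scale_two flip: words.scale_scale)
next
  case (snoc b u)
  let ?F = "fold snoc u C"
  let ?W = "alt par y z (fold snoc (a # u @ b # v) C)"
  let ?I = "alt par y z (fold snoc (b # v) (zmul par (gen a) ?F +
        smult (koszul (par a * (q + wpar par u))) (snoc a ?F)))"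
    and ?M = "alt par y z (fold snoc ((u @ [b]) @ a # v) C)"
    and ?k = "koszul (par a * (q + wpar par (u @ [b]))) :: 'k"
  have F: "?F \<in> Zin_part X par (q + wpar par u)"
    by (rule fold_snoc_in_Zin_part[OF C(2)]) (use snoc.prems in auto)
  \<comment> \<open>Either \<open>a\<close> stands before \<open>b\<close>, and \<open>b\<close>
    joins the inert suffix \<open>v\<close>, or \<open>a\<close> follows \<open>b\<close> and is
    moved to the front; the latter adds one to the count.\<close>
  have "?I - smult (of_nat (length u + 2) * koszul (par a * q)) ?W \<in> ST X par"
    by (rule snoc.IH) (use snoc.prems in auto)
  moreover have "?M - smult (koszul (wpar par (u @ [b]) * par a)) (alt par y z (fold snoc (a # (u @ [b]) @ v) C)) \<in> ST X par"
    by (rule alt_fold_snoc_move[OF C]) (use snoc.prems a y z in auto)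
  ultimately have "(?I - smult (of_nat (length u + 2) * koszul (par a * q)) ?W) +
      smult ?k (?M - smult (koszul (wpar par (u @ [b]) * par a)) ?W) \<in> ST X par"
    by (intro ST_add ST_smult) simp_all
  moreover have "?k * koszul (wpar par (u @ [b]) * par a) = (koszul (par a * q) :: 'k)"
    by (cases "par a"; cases "par b"; cases "wpar par u"; cases q) simp_all
  moreover have "(i - smult (of_nat l * k) w) + smult k' (m - smult k'' w) =
      i + smult k' m - smult (of_nat (Suc l) * k) w" if "k' * k'' = k"
    for i m w :: "('x, 'k) words" and k k' k'' l
    by (simp add: that words.scale_right_diff_distrib words.scale_left_distrib distrib_right)
  ultimately have "?I + smult ?k ?M - smult (of_nat (Suc (length u + 2)) * koszul (par a * q)) ?W \<in> ST X par"
    by (simp only:)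
  then show ?case
    using zmul_snoc[OF gen_in_Zin_part[OF a, of par] F, of b] by (simp add: zmul_gen)
qed

end

text \<open>The letter \<open>a\<close> enters before, between or after the pair. The last two kinds
  regroup into the alternated pairs \<open>z\<close>, \<open>a\<close> and \<open>a\<close>,
  \<open>y\<close>.\<close>

lemma superbracket_gen_alt:
  assumes f: "f \<in> Zin_part X par r" and a: "a \<in> X" and y: "y \<in> X" and z: "z \<in> X"
  shows "superbracket par (gen a) (alt par y z f) =
    alt par y z (zmul par (gen a) f + smult (koszul (par a * r)) (snoc a f)) -
    smult (koszul (par a * (r + par y + par z))) (alt par z a (snoc y f)) -
    smult (koszul (par y * par z + par a * (r + par z))) (alt par a y (snoc z f))"
proof -
  have *: "zmul par (gen a) (snoc z (snoc y f)) =
     snoc z (snoc y (zmul par (gen a) f + smult (koszul (par a * r)) (snoc a f)) +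
       smult (koszul (par a * (r + par y))) (snoc a (snoc y f)))" if "y \<in> X" for y z
    using zmul_snoc[OF gen_in_Zin_part[OF a, of par] f, of y]
      zmul_snoc[OF gen_in_Zin_part[OF a, of par] snoc_in_Zin_part[OF f that], of z]
    by (simp add: zmul_gen)
  show ?thesis
    unfolding superbracket_eq[OF gen_in_Zin_part[OF a] alt_in_Zin_part[OF f y z]] zmul_gen
    unfolding alt_def zmul_diff zmul_simps *[OF y] *[OF z]
    by (rule poly_mapping_eqI, cases r; cases "par a"; cases "par y"; cases "par z")
      (simp_all add: lookup_add lookup_minus lookup_smult)
qed

text \<open>Induction on the length of \<open>w\<close>, with C varying over ST. Lengths 0 and 1 are
  done; otherwise brackets of generators with elements for the shorter word \<open>c\<close> give a
  cyclic system.\<close>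

lemma alt_fold_snoc_in_ST:
  fixes C :: "('x, 'k::field_char_0) words"
  assumes "C \<in> ST X par" "C \<in> Zin_part X par q" "set w \<subseteq> X" "y \<in> X" "z \<in> X"
  shows "alt par y z (fold snoc w C) \<in> ST X par"
  using assms
proof (induction "length w" arbitrary: C q w y z rule: less_induct)
  case less
  note C = less.prems(1,2)
  consider "w = []" | x where "w = [x]" | x c where "w = x # c" "c \<noteq> []"
    by (metis list.exhaust)
  then show ?case
  proof cases
    case 1
    with less.prems show ?thesis by (simp add: alt_in_ST)
  next
    case 2
    with less.prems show ?thesis by (simp add: alt_snoc_in_ST)
  next
    case (3 x c)
    have shorter: "alt par y z (fold snoc w' C') \<in> ST X par"
      if "C' \<in> ST X par" "C' \<in> Zin_part X par q'" "set w' \<subseteq> X" "length w' < Suc (length c)" "y \<in> X" "z \<in> X"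
      for C' :: "('x, 'k) words" and q' w' y z
      by (rule less.hyps[where q = q']) (use that 3 in auto)
    have c: "set c \<subseteq> X" using less.prems 3 by simp
    let ?G = "fold snoc c C" and ?r = "q + wpar par c"
    have G: "?G \<in> Zin_part X par ?r"
      by (rule fold_snoc_in_Zin_part[OF C(2) c])
    let ?F = "\<lambda>x y z. alt par y z (fold snoc (x # c) C)"
    have "?F x y z \<in> ST X par"
    proof (rule cyclic_in_ST[where F = ?F and \<kappa> = "of_nat (length c + 2)" and b = "wpar par c"])
      fix x y z
      assume X: "x \<in> X" "y \<in> X" "z \<in> X"
      have br: "superbracket par (gen x) (alt par y z ?G) \<in> ST X par"
        by (intro ST_superbracket ST_gen shorter[OF C]) (use X c in auto)
      have ins: "alt par y z (zmul par (gen x) ?G + smult (koszul (par x * ?r)) (snoc x ?G)) -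
          smult (of_nat (length c + 2) * koszul (par x * q)) (?F x y z) \<in> ST X par"
        using alt_fold_snoc_insert[OF shorter C, where a = x and u = c and v = "[]" and y = y and z = z] X c by simp
      have move: "alt par z x (snoc y ?G) - smult (koszul (wpar par c * par y)) (?F y z x) \<in> ST X par"
        if "x \<in> X" "y \<in> X" "z \<in> X" for x y z
        using alt_fold_snoc_move[OF shorter C, where u = c and a = y and v = "[]" and y = z and z = x] that c by simp
      let ?I = "alt par y z (zmul par (gen x) ?G + smult (koszul (par x * ?r)) (snoc x ?G))"
        and ?My = "alt par z x (snoc y ?G)" and ?Mz = "alt par x y (snoc z ?G)"
        and ?k = "koszul (par x * q)" and ?\<kappa> = "of_nat (length c + 2)"
        and ?ky = "koszul (par x * (?r + par y + par z))" and ?ly = "koszul (wpar par c * par y)"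
        and ?kz = "koszul (par y * par z + par x * (?r + par z))" and ?lz = "koszul (wpar par c * par z)"
      \<comment> \<open>The bracket is corrected by the errors of insertion and of moving
        \<open>y\<close> and \<open>z\<close> to the front; the factor \<open>?k\<close> removes the
        sign of the leading term.\<close>
      let ?e = "smult ?k (superbracket par (gen x) (alt par y z ?G) - (?I - smult (?\<kappa> * ?k) (?F x y z)) +
        smult ?ky (?My - smult ?ly (?F y z x)) + smult ?kz (?Mz - smult ?lz (?F z x y)))"
      have "?e \<in> ST X par"
        by (intro ST_smult[of "_ + _"] ST_add[OF ST_add[OF ST_diff[OF br ins]]] ST_smult[OF move] X)
      moreover have "?e = smult ?\<kappa> (?F x y z) -
          smult (koszul (par x * (wpar par c + par y + par z) + wpar par c * par y)) (?F y z x) -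
          smult (koszul (par z * (wpar par c + par x + par y) + wpar par c * par x)) (?F z x y)"
      proof -
        have cancel: "smult k (i - smult m a - smult n b - (i - smult (\<kappa> * k) f) +
            smult m (a - smult m' g) + smult n (b - smult n' h)) =
          smult (\<kappa> * (k * k)) f - smult (k * m * m') g - smult (k * n * n') h"
          for k m n m' n' \<kappa> :: 'k and a b f g h i :: "('x, 'k) words"
          by (rule poly_mapping_eqI) (simp add: lookup_add lookup_minus lookup_smult algebra_simps)
        have "koszul (par x * (wpar par c + par y + par z) + wpar par c * par y) = (?k * ?ky * ?ly :: 'k)"
          "koszul (par z * (wpar par c + par x + par y) + wpar par c * par x) = (?k * ?kz * ?lz :: 'k)"
          by (cases q; cases "wpar par c"; cases "par x"; cases "par y"; cases "par z"; simp)+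
        then show ?thesis
          unfolding superbracket_gen_alt[OF G X] cancel by (simp only: koszul_times_koszul mult_1_right)
      qed
      ultimately show "smult (of_nat (length c + 2)) (?F x y z) -
          smult (koszul (par x * (wpar par c + par y + par z) + wpar par c * par y)) (?F y z x) -
          smult (koszul (par z * (wpar par c + par x + par y) + wpar par c * par x)) (?F z x y) \<in> ST X par"
        by (simp only:)
    next
      have "of_nat (length c + 2) + 1 = (of_nat (length c + 3) :: 'k)" by simp
      also have "\<dots> \<noteq> 0" unfolding of_nat_eq_0_iff by simp
      finally show "of_nat (length c + 2) \<noteq> (- 1 :: 'k)" by (simp only: eq_neg_iff_add_eq_0 not_False_eq_True)
      \<comment> \<open>Nonemptiness of \<open>c\<close> enters here: one intermediate letter would
        give the singular value 2.\<close>
      show "of_nat (length c + 2) \<noteq> (2 :: 'k)" using 3 by simp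
    qed (use less.prems 3 in auto)
    with 3 show ?thesis by simp
  qed
qed

section \<open>Images of 1 - p and the equivalence\<close>

text \<open>A two-letter word gives the bracket of two generators. A longer one starts with a
  generator x, and C = x is in ST.\<close>

lemma word_minus_p_word_in_ST:
  assumes "w \<in> lists X" "length w > 1"
  shows "(word w - p_word par w :: ('x, 'k::field_char_0) words) \<in> ST X par"
proof -
  obtain u y z where w: "w = u @ [y, z]"
  proof (cases w rule: rev_cases)
    case (snoc w' z)
    with assms(2) that show ?thesis by (cases w' rule: rev_cases) auto
  qed (use assms in simp)
  have eq: "word w - p_word par w = (alt par y z (word u) :: ('x, 'k) words)"
    by (simp add: w p_word_def alt_def)
  show ?thesis
  proof (cases u)
    case Nil
    have "alt par y z (word u) = (superbracket par (gen y) (gen z) :: ('x, 'k) words)"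
      by (simp add: Nil alt_def)
    then show ?thesis
      unfolding eq using assms w by (simp del: superbracket_simps add: ST_superbracket ST_gen)
  next
    case (Cons x v)
    have "(alt par y z (fold snoc v (gen x)) :: ('x, 'k) words) \<in> ST X par"
      by (rule alt_fold_snoc_in_ST[where q = "par x"])
        (use assms w Cons in \<open>auto intro!: ST_gen gen_in_Zin_part\<close>)
    then show ?thesis unfolding eq by (simp add: Cons fold_snoc_word)
  qed
qed

theorem theorem5p4:
  fixes X :: "'x set" and par :: "'x \<Rightarrow> bit" and f :: "('x, 'k::field_char_0) words" and n :: nat
  assumes "f \<in> Zin X" and "homogeneous_of_degree n f" and "n > 1"
  shows "f \<in> ST X par \<longleftrightarrow> p_map par f = - f"
proof
  assume "f \<in> ST X par"
  then show "p_map par f = - f" by (rule p_map_ST)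
next
  assume p: "p_map par f = - f"
  have "Poly_Mapping.keys f \<subseteq> {w \<in> lists X. length w > 1}"
    using assms by (auto simp: Zin_def homogeneous_of_degree_def)
  then have "f - p_map par f \<in> ST X par"
  proof (induction rule: words_induct)
    case zero
    show ?case by (simp add: ST_zero)
  next
    case (add f g)
    then show ?case using ST_add[of "f - p_map par f" X par "g - p_map par g"] by (simp add: algebra_simps)
  next
    case (word k w)
    then show ?case
      using ST_smult[OF word_minus_p_word_in_ST[of w X par], of k]
      by (simp add: words.scale_right_diff_distrib)
  qed
  \<comment> \<open>For skew f, (1 - p)f = 2f, and 2 is invertible.\<close>
  then have "smult 2 f \<in> ST X par" by (simp add: p scale_two)
  then show "f \<in> ST X par" by (rule ST_smultD) simp
qed

end
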